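(* Let $r\ge 3$ and let $F$ be a graph with chromatic number $\chi(F)=r+1\ge 4$ that has a color-critical edge. Then $C_4$ is $F$-Turán-stable: for every $\varepsilon>0$ there exist $\delta>0$ and $n_0$ such that every $F$-free graph $G$ on $n\ge n_0$ vertices with $N(C_4,G)\ge \mathrm{ex}(n,C_4,F)-\delta n^4$ can be obtained from $T_r(n)$ by adding and removing at most $\varepsilon n^2$ edges (i.e., after a suitable identification of vertex sets, $G$ and $T_r(n)$ differ in at most $\varepsilon n^2$ vertex pairs).
   Context: All graphs are finite and simple. $C_4$ is the cycle of length four. An edge $e$ of $F$ is color-critical if $\chi(F-e)<\chi(F)$. A graph is $F$-free if it contains no subgraph isomorphic to $F$. $N(H,G)$ is the number of (not necessarily induced) subgraphs of $G$ isomorphic to $H$, and $\mathrm{ex}(n,H,F)$ is the maximum of $N(H,G)$ over all $F$-free graphs $G$ on $n$ vertices. $T_r(n)$ is the complete $r$-partite graph on $n$ vertices with part sizes $\lceil n/r\rceil$ or $\lfloor n/r\rfloor$. (The paper phrases the conclusion as: every $n$-vertex $F$-free $G$ with $N(C_4,G)\ge \mathrm{ex}(n,C_4,F)-o(n^4)$ can be obtained from $T_r(n)$ by adding and removing $o(n^2)$ edges.) *)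

theory Defs
  imports Complex_Main
begin

record 'a graph =
  verts :: "'a set"
  edges :: "'a set set"

definition simple_graph :: "'a graph \<Rightarrow> bool" where
  "simple_graph G \<longleftrightarrow> finite (verts G) \<and> (\<forall>e \<in> edges G. e \<subseteq> verts G \<and> card e = 2)"

definition subgraph :: "'a graph \<Rightarrow> 'a graph \<Rightarrow> bool" where
  "subgraph S G \<longleftrightarrow> simple_graph S \<and> verts S \<subseteq> verts G \<and> edges S \<subseteq> edges G"

definition graph_iso :: "'a graph \<Rightarrow> 'b graph \<Rightarrow> bool" where
  "graph_iso G H \<longleftrightarrow> (\<exists>f. bij_betw f (verts G) (verts H) \<and> (\<lambda>e. f ` e) ` edges G = edges H)"

definition free_of :: "'b graph \<Rightarrow> 'a graph \<Rightarrow> bool" where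
  "free_of F G \<longleftrightarrow> \<not> (\<exists>S. subgraph S G \<and> graph_iso S F)"

definition num_copies :: "'b graph \<Rightarrow> 'a graph \<Rightarrow> nat" where
  "num_copies H G = card {S. subgraph S G \<and> graph_iso S H}"

text \<open>Since all notions are invariant under isomorphism, it suffices to let the \<open>n\<close>-vertex graphs
  range over the (finitely many) graphs with vertex set \<open>{..<n}\<close>. The maximum is over a nonempty set
  whenever \<open>F\<close> has an edge.\<close>

definition ex_turan :: "nat \<Rightarrow> 'b graph \<Rightarrow> 'a graph \<Rightarrow> nat" where
  "ex_turan n H F =
     Max {num_copies H G |G :: nat graph. simple_graph G \<and> verts G = {..<n} \<and> free_of F G}"

definition proper_colouring :: "'a graph \<Rightarrow> nat \<Rightarrow> ('a \<Rightarrow> nat) \<Rightarrow> bool" where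
  "proper_colouring G k c \<longleftrightarrow>
     (\<forall>v \<in> verts G. c v < k) \<and> (\<forall>u v. {u, v} \<in> edges G \<longrightarrow> c u \<noteq> c v)"

definition chromatic_number :: "'a graph \<Rightarrow> nat" where
  "chromatic_number G = (LEAST k. \<exists>c. proper_colouring G k c)"

definition delete_edge :: "'a graph \<Rightarrow> 'a set \<Rightarrow> 'a graph" where
  "delete_edge G e = G\<lparr>edges := edges G - {e}\<rparr>"

definition color_critical_edge :: "'a graph \<Rightarrow> 'a set \<Rightarrow> bool" where
  "color_critical_edge G e \<longleftrightarrow>
     e \<in> edges G \<and> chromatic_number (delete_edge G e) < chromatic_number G"

definition C4 :: "nat graph" where
  "C4 = \<lparr>verts = {0, 1, 2, 3}, edges = {{0, 1}, {1, 2}, {2, 3}, {3, 0}}\<rparr>"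

text \<open>\<open>is_turan_graph r n T\<close>: \<open>T\<close> is a copy of \<open>T\<^sub>r(n)\<close> on its own vertex set; \<open>p\<close> maps each vertex to
  the index of its part, and parts are allowed to be empty (when \<open>n < r\<close>).\<close>

definition is_turan_graph :: "nat \<Rightarrow> nat \<Rightarrow> 'a graph \<Rightarrow> bool" where
  "is_turan_graph r n T \<longleftrightarrow>
     finite (verts T) \<and> card (verts T) = n \<and>
     (\<exists>p :: 'a \<Rightarrow> nat.
        (\<forall>v \<in> verts T. p v < r) \<and>
        (\<forall>i < r. int (card {v \<in> verts T. p v = i})
                   \<in> {\<lfloor>real n / real r\<rfloor>, \<lceil>real n / real r\<rceil>}) \<and>
        edges T = {{u, v} |u v. u \<in> verts T \<and> v \<in> verts T \<and> p u \<noteq> p v})"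

end

theory Submission
  imports Defs "HOL-Analysis.Convex" "HOL-Combinatorics.Multiset_Permutations"
begin

text \<open>
  Let \<open>t\<^sub>s\<close> be the labelled \<open>K\<^sub>s\<close>-density of \<open>G\<close>. Any two of the three perfect matchings of a
  4-set form a 4-cycle on it, and inclusion-exclusion over the two 4-cycles through a fixed matching
  shows that twice the \<open>C\<^sub>4\<close>-density is at most \<open>t\<^sub>2\<^sup>2 + t\<^sub>4\<close>, asymptotically with equality for \<open>T\<^sub>r(n)\<close>.
  An \<open>F\<close>-free graph has \<open>t\<^sub>r\<^sub>+\<^sub>1 = o(1)\<close> by Erdos' theorem on complete multipartite hypergraphs, so
  the Moon-Moser inequalities bound \<open>t\<^sub>2\<close>, \<open>t\<^sub>3\<close> and \<open>t\<^sub>4\<close> by their values on \<open>T\<^sub>r(n)\<close>, up to \<open>o(1)\<close>.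
  Nearly maximal \<open>C\<^sub>4\<close>-density therefore forces nearly maximal edge density, and it remains to prove
  the Erdos-Simonovits stability theorem. There Moon-Moser shows that almost all degrees are close to
  \<open>(1 - 1/r)n\<close>; the parts are then read off the neighbourhoods of a typical \<open>r\<close>-clique of such
  vertices.
\<close>

section \<open>Cliques and the Moon-Moser inequalities\<close>

text \<open>In a complete multipartite graph non-adjacency is an equivalence relation. Hence, for
  edges \<open>ab\<close> and \<open>cd\<close>, if \<open>bc\<close> or \<open>da\<close> is
  missing then \<open>bd\<close> and \<open>ca\<close> are both present: every ordered pair of edges
  lies in one of the two closed walks \<open>abcd\<close>, \<open>abdc\<close>, and in both exactly
  when the four vertices span a \<open>K_4\<close>. This is why the bound by
  \<open>t_2^2 + t_4\<close> is tight for \<open>T_r(n)\<close>. Since \<open>t_2\<close> and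
  \<open>t_4\<close> are asymptotically maximal there at the same time, a deficit in
  \<open>t_2\<close> cannot be made up by \<open>t_4\<close>. The assumption
  \<open>r \<ge> 3\<close> enters through \<open>1 - 3/r \<ge> 0\<close>, which lets an upper bound
  on \<open>t_3\<close> be inserted into the one for \<open>t_4\<close>. Moon-Moser in its usual
  form compares ratios of consecutive clique counts, and these are unstable when a clique density is
  tiny. All errors are therefore kept additive, as \<open>t_(s+1) \<le> (1 - s/r) t_s + c\<close>.
  The case \<open>s = 2\<close> also bounds the second moment of the degrees by nearly the square of
  their mean, which is the source of the degree concentration.\<close>

locale finite_graph =
  fixes G :: "'a graph"
  assumes simple: "simple_graph G"
begin

abbreviation V where "V \<equiv> verts G"
abbreviation adj where "adj x y \<equiv> {x, y} \<in> edges G"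

text \<open>The ambient set \<open>W\<close> is a parameter because the stability argument looks for
  cliques among the vertices of high degree, while \<open>cnbrs\<close> always refers to the whole
  graph.\<close>

definition cliques :: "'a set \<Rightarrow> nat \<Rightarrow> 'a set set" where
  "cliques W s = {Q. Q \<subseteq> W \<and> card Q = s \<and> (\<forall>x\<in>Q. \<forall>y\<in>Q. x \<noteq> y \<longrightarrow> adj x y)}"

definition cnbrs :: "'a set \<Rightarrow> 'a set" where
  "cnbrs Q = {v \<in> V. \<forall>x\<in>Q. adj x v}"

lemma finV [simp]: "finite V"
  using simple by (simp add: simple_graph_def)

lemma adj_irrefl [simp]: "{x} \<notin> edges G"
  using simple by (force simp: simple_graph_def)

lemma adj_V: "adj x y \<Longrightarrow> x \<in> V \<and> y \<in> V"
  using simple by (force simp: simple_graph_def)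

lemma finite_cliques [simp]: "finite W \<Longrightarrow> finite (cliques W s)"
  by (rule finite_subset[of _ "Pow W"]) (auto simp: cliques_def)

lemma finite_cnbrs [simp]: "finite (cnbrs Q)"
  by (simp add: cnbrs_def)

lemma cnbrs_subset: "cnbrs Q \<subseteq> V"
  by (auto simp: cnbrs_def)

lemma cnbrs_disjoint: "v \<in> cnbrs Q \<Longrightarrow> v \<notin> Q"
  using adj_irrefl[of v] by (force simp: cnbrs_def)

lemma finite_clique: "Q \<in> cliques W s \<Longrightarrow> finite W \<Longrightarrow> finite Q"
  by (auto simp: cliques_def intro: finite_subset)

lemma cliques_mono: "W \<subseteq> W' \<Longrightarrow> cliques W s \<subseteq> cliques W' s"
  by (auto simp: cliques_def)

lemma clique_insert:
  assumes "R \<in> cliques W s" "x \<in> cnbrs R \<inter> W" "finite W"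
  shows "insert x R \<in> cliques W (Suc s)"
  using assms cnbrs_disjoint[of x R] finite_clique[OF assms(1,3)]
  by (auto simp: cliques_def cnbrs_def insert_commute)

lemma clique_remove:
  assumes "Q \<in> cliques W (Suc s)" "x \<in> Q" "W \<subseteq> V"
  shows "Q - {x} \<in> cliques W s" "x \<in> cnbrs (Q - {x}) \<inter> W"
  using assms by (auto simp: cliques_def cnbrs_def card_Diff_singleton_if)

text \<open>Marking a vertex \<open>x\<close> of an \<open>(s+1)\<close>-clique \<open>Q\<close> is
  the same as extending the \<open>s\<close>-clique \<open>Q - {x}\<close> by a common neighbour.
  The free weight \<open>f\<close> lets this one double count serve for clique numbers, for second
  moments and for edges inside common neighbourhoods.\<close>

lemma sum_cliques_Suc:
  assumes "W \<subseteq> V"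
  shows "(\<Sum>Q\<in>cliques W (Suc s). \<Sum>x\<in>Q. f (Q - {x}) x) = (\<Sum>R\<in>cliques W s. \<Sum>x\<in>cnbrs R \<inter> W. f R x)"
proof -
  have fW: "finite W" using assms finV finite_subset by blast
  have "(\<Sum>Q\<in>cliques W (Suc s). \<Sum>x\<in>Q. f (Q - {x}) x)
      = (\<Sum>(Q,x)\<in>Sigma (cliques W (Suc s)) (\<lambda>Q. Q). f (Q - {x}) x)"
    using fW by (subst sum.Sigma) (auto intro: finite_clique)
  also have "\<dots> = (\<Sum>(R,x)\<in>Sigma (cliques W s) (\<lambda>R. cnbrs R \<inter> W). f R x)"
    by (rule sum.reindex_bij_witness[of _ "\<lambda>(R,x). (insert x R, x)" "\<lambda>(Q,x). (Q - {x}, x)"])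
      (use assms fW in \<open>auto simp: insert_absorb dest: cnbrs_disjoint intro: clique_insert clique_remove clique_remove(2)[THEN IntD1] clique_remove(2)[THEN IntD2]\<close>)
  also have "\<dots> = (\<Sum>R\<in>cliques W s. \<Sum>x\<in>cnbrs R \<inter> W. f R x)"
    using fW by (subst sum.Sigma) auto
  finally show ?thesis .
qed

lemma sum_card_cnbrs:
  assumes "W \<subseteq> V"
  shows "(\<Sum>R\<in>cliques W s. card (cnbrs R \<inter> W)) = Suc s * card (cliques W (Suc s))"
proof -
  have "(\<Sum>Q\<in>cliques W (Suc s). \<Sum>x\<in>Q. 1::nat) = (\<Sum>R\<in>cliques W s. \<Sum>x\<in>cnbrs R \<inter> W. 1)"
    by (rule sum_cliques_Suc[OF assms, where f="\<lambda>_ _. 1"])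
  moreover have "(\<Sum>Q\<in>cliques W (Suc s). \<Sum>x\<in>Q. 1::nat) = (\<Sum>Q\<in>cliques W (Suc s). Suc s)"
    by (rule sum.cong) (auto simp: cliques_def)
  ultimately show ?thesis by simp
qed

text \<open>A vertex adjacent to all of \<open>Q\<close> is counted \<open>s + 1\<close> times on
  the left, a vertex with exactly one non-neighbour \<open>x\<close> in \<open>Q\<close> once (these
  form \<open>D x\<close>), and any other vertex not at all. One count per vertex is paid by
  \<open>card V\<close>, the remaining \<open>s\<close> by \<open>cnbrs Q\<close>.\<close>

lemma sum_cnbrs_remove_le:
  assumes "finite Q" "card Q = Suc s"
  shows "(\<Sum>x\<in>Q. card (cnbrs (Q - {x}))) \<le> card V + s * card (cnbrs Q)"
proof -
  define D where "D x = cnbrs (Q - {x}) - cnbrs Q" for x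
  have fD: "finite (D x)" for x by (simp add: D_def)
  have c: "card (cnbrs (Q - {x})) = card (cnbrs Q) + card (D x)" for x
  proof -
    have "cnbrs (Q - {x}) = cnbrs Q \<union> D x" by (auto simp: D_def cnbrs_def)
    then have "card (cnbrs (Q - {x})) = card (cnbrs Q \<union> D x)" by simp
    also have "\<dots> = card (cnbrs Q) + card (D x)"
      by (rule card_Un_disjoint) (auto simp: D_def)
    finally show ?thesis .
  qed
  have disj: "D x \<inter> D y = {}" if "x \<noteq> y" for x y
    using that by (auto simp: D_def cnbrs_def)
  have "(\<Sum>x\<in>Q. card (D x)) = card (\<Union>x\<in>Q. D x)"
    using disj assms fD by (subst card_UN_disjoint) auto
  moreover have "card (cnbrs Q) + card (\<Union>x\<in>Q. D x) = card (cnbrs Q \<union> (\<Union>x\<in>Q. D x))"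
    using assms fD by (subst card_Un_disjoint) (auto simp: D_def)
  moreover have "card (cnbrs Q \<union> (\<Union>x\<in>Q. D x)) \<le> card V"
    using cnbrs_subset by (intro card_mono) (auto simp: D_def)
  ultimately show ?thesis using assms by (simp add: c sum.distrib)
qed

lemma sum_cnbrs_squared_le:
  "(\<Sum>R\<in>cliques V s. card (cnbrs R) ^ 2)
     \<le> card V * card (cliques V (Suc s)) + s * (s + 2) * card (cliques V (s + 2))"
proof -
  have cV: "cnbrs R \<inter> V = cnbrs R" for R using cnbrs_subset by auto
  have "(\<Sum>R\<in>cliques V s. card (cnbrs R) ^ 2) = (\<Sum>R\<in>cliques V s. \<Sum>x\<in>cnbrs R \<inter> V. card (cnbrs R))"
    by (simp add: cV power2_eq_square)
  also have "\<dots> = (\<Sum>Q\<in>cliques V (Suc s). \<Sum>x\<in>Q. card (cnbrs (Q - {x})))"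
    by (rule sum_cliques_Suc[symmetric]) simp
  also have "\<dots> \<le> (\<Sum>Q\<in>cliques V (Suc s). card V + s * card (cnbrs Q))"
    by (intro sum_mono sum_cnbrs_remove_le) (auto simp: cliques_def intro: finite_subset[OF _ finV])
  also have "\<dots> = card V * card (cliques V (Suc s)) + s * (\<Sum>Q\<in>cliques V (Suc s). card (cnbrs Q \<inter> V))"
    by (simp add: sum.distrib sum_distrib_left cV)
  also have "\<dots> = card V * card (cliques V (Suc s)) + s * (s + 2) * card (cliques V (s + 2))"
    by (subst sum_card_cnbrs) (simp_all add: algebra_simps)
  finally show ?thesis .
qed

text \<open>Cauchy-Schwarz for the numbers of common neighbours of the \<open>s\<close>-cliques,
  combined with the bound on their second moment. The products are left multiplied out, so that no
  clique count has to be nonzero.\<close>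

lemma moon_moser:
  "(Suc s * card (cliques V (Suc s)))^2
     \<le> card (cliques V s) * (card V * card (cliques V (Suc s)) + s * (s + 2) * card (cliques V (s + 2)))"
proof -
  have cV: "cnbrs R \<inter> V = cnbrs R" for R using cnbrs_subset by auto
  have "real ((Suc s * card (cliques V (Suc s)))^2) = (\<Sum>R\<in>cliques V s. real (card (cnbrs R)))^2"
    using arg_cong[OF sum_card_cnbrs[of V s, OF subset_refl], of real] by (simp only: cV of_nat_sum of_nat_power)
  also have "\<dots> \<le> (\<Sum>R\<in>cliques V s. (real (card (cnbrs R)))^2) * card (cliques V s)"
    by (rule sum_squared_le_sum_of_squares)
  also have "\<dots> = real (card (cliques V s) * (\<Sum>R\<in>cliques V s. card (cnbrs R) ^ 2))"
    by simp
  finally show ?thesis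
    using sum_cnbrs_squared_le[of s] by (meson le_trans mult_le_mono2 of_nat_le_iff)
qed

text \<open>For nonempty \<open>V\<close>, the probability that \<open>s\<close> independent uniform
  vertices are pairwise adjacent. Normalising by \<open>n^s\<close> instead of a falling factorial
  removes \<open>n\<close> from the Moon-Moser inequality.\<close>

definition cdens :: "nat \<Rightarrow> real" where
  "cdens s = fact s * card (cliques V s) / real (card V) ^ s"

lemma card_cliques_cdens:
  "V \<noteq> {} \<Longrightarrow> real (card (cliques V s)) = cdens s * real (card V) ^ s / fact s"
  by (simp add: cdens_def)

lemma cdens_nonneg [simp]: "0 \<le> cdens s"
  by (simp add: cdens_def)

lemma cliques_0: "cliques W 0 = {{}}" if "finite W"
  using that by (auto simp: cliques_def dest: finite_subset)

lemma cdens_0: "cdens 0 = 1"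
  by (simp add: cdens_def cliques_0)

lemma cdens_Suc_le: "cdens (Suc s) \<le> cdens s"
proof (cases "V = {}")
  case True
  then show ?thesis by (simp add: cdens_def)
next
  case False
  then have n: "real (card V) > 0" by (simp add: card_gt_0_iff)
  have "Suc s * card (cliques V (Suc s)) \<le> (\<Sum>R\<in>cliques V s. card V)"
    unfolding sum_card_cnbrs[of V s, OF subset_refl, symmetric] by (intro sum_mono card_mono) auto
  then have "real (Suc s * card (cliques V (Suc s))) \<le> real (card (cliques V s) * card V)"
    by (simp only: of_nat_le_iff sum_constant of_nat_id)
  then have "fact s * real (card V) ^ s * real (Suc s * card (cliques V (Suc s)))
      \<le> fact s * real (card V) ^ s * real (card (cliques V s) * card V)"
    by (intro mult_left_mono) auto
  then show ?thesis using n by (simp add: cdens_def field_simps)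
qed

lemma cdens_1: "V \<noteq> {} \<Longrightarrow> cdens 1 = 1"
proof -
  assume "V \<noteq> {}"
  moreover have "cliques V 1 = (\<lambda>x. {x}) ` V"
    by (auto simp: cliques_def card_1_singleton_iff)
  then have "card (cliques V 1) = card V" by (simp add: card_image)
  ultimately show ?thesis by (simp add: cdens_def)
qed

lemma cdens_le_1: "cdens s \<le> 1"
  by (induction s) (use cdens_0 cdens_Suc_le order_trans in \<open>auto\<close>)

lemma cdens_moon_moser:
  "real (Suc s) * cdens (Suc s) ^ 2 \<le> cdens s * (cdens (Suc s) + s * cdens (s + 2))"
proof (cases "V = {}")
  case True
  then show ?thesis by (simp add: cdens_def)
next
  case False
  define n where "n = real (card V)"
  have n: "n > 0" using False by (simp add: card_gt_0_iff n_def)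
  define a b c where "a = cdens s" "b = cdens (Suc s)" "c = cdens (s + 2)"
  note e = card_cliques_cdens[OF False]
  have "(real (Suc s) * card (cliques V (Suc s)))^2
     \<le> card (cliques V s) * (n * card (cliques V (Suc s)) + real s * real (s + 2) * real (card (cliques V (s + 2))))"
    using moon_moser[of s] unfolding n_def by (metis (mono_tags, lifting) of_nat_add of_nat_le_iff of_nat_mult of_nat_power)
  then have "(real (Suc s) * (b * n ^ Suc s / fact (Suc s)))^2
     \<le> a * n ^ s / fact s * (n * (b * n ^ Suc s / fact (Suc s)) + real s * real (s + 2) * (c * n ^ (s + 2) / fact (s+2)))"
    unfolding e a_b_c_def n_def of_nat_mult .
  have f1: "(fact (Suc s) :: real) = fact s * real (Suc s)" and p1: "real (Suc s) \<noteq> 0" "real (s + 2) \<noteq> 0"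
    by (simp_all add: algebra_simps)
  have f2: "(fact (s + 2) :: real) = real (s + 2) * (fact s * real (Suc s))"
    by (simp add: algebra_simps)
  have cancel: "w * (x / (f * w)) = x / f" if "w \<noteq> 0" for w x f :: real
    using that by simp
  have "real (Suc s) * (b * n ^ Suc s / fact (Suc s)) = b * n ^ Suc s / fact s"
    unfolding f1 by (rule cancel[OF p1(1)])
  moreover have "n * (b * n ^ Suc s / fact (Suc s)) = b * n ^ (s + 2) / (fact s * real (Suc s))"
    unfolding f1 by (simp add: mult_ac del: of_nat_Suc)
  moreover have "real s * real (s + 2) * (c * n ^ (s + 2) / fact (s + 2)) = s * c * n ^ (s + 2) / (fact s * real (Suc s))"
    unfolding f2 using p1 by (simp add: mult_ac del: of_nat_Suc of_nat_add)
  moreover note \<open>(real (Suc s) * (b * n ^ Suc s / fact (Suc s)))^2 \<le> _\<close>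
  ultimately have "(b * n ^ Suc s / fact s)^2
      \<le> a * n ^ s / fact s * (b * n ^ (s + 2) / (fact s * real (Suc s)) + s * c * n ^ (s + 2) / (fact s * real (Suc s)))"
    by metis
  also have "\<dots> = (a * (b + s * c) / Suc s) * (n ^ s * n ^ (s + 2) / (fact s * fact s))"
    by (simp add: add_divide_distrib distrib_left distrib_right mult_ac)
  also have "(b * n ^ Suc s / fact s)^2 = b^2 * (n ^ s * n ^ (s + 2) / (fact s * fact s))"
    by (simp add: power2_eq_square mult_ac)
  finally have "b^2 \<le> a * (b + s * c) / Suc s"
    by (rule mult_right_le_imp_le) (use n in simp)
  then show ?thesis unfolding a_b_c_def by (simp add: field_simps)
qed

end

section \<open>Few cliques in graphs without a fixed subgraph\<close>

lemma exists_weighted_average: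
  fixes f :: "'b \<Rightarrow> real"
  assumes "finite T" "real (card T) * c \<le> sum f T" "T \<noteq> {}"
  shows "\<exists>S\<in>T. c \<le> f S"
proof (rule ccontr)
  assume "\<not> ?thesis"
  then have "sum f T < (\<Sum>S\<in>T. c)"
    using assms by (intro sum_strict_mono) auto
  then show False using assms by simp
qed

text \<open>The Kovari-Sos-Turan averaging in the bipartite graph that joins \<open>y\<close> to the
  members of \<open>Nb y\<close>. A fraction \<open>\<eta> / 2\<close> of the \<open>y\<close> have
  at least \<open>\<eta> * n / 2\<close> neighbours, and each of these neighbourhoods contains at
  least \<open>(\<eta> * n / (2 * t))^t\<close> of the at most \<open>n^t\<close> sets of size
  \<open>t\<close>. Some \<open>t\<close>-set therefore lies in the stated number of
  neighbourhoods.\<close>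

lemma exists_common_box_step:
  fixes \<eta> :: real and V :: "'a set"
  assumes \<eta>: "0 < \<eta>" and V: "finite V" and n: "real (card V) \<ge> 2 * real t / \<eta>" "V \<noteq> {}"
    and Y: "finite Y" "real (card Y) = N" and N: "N > 0"
    and R: "\<And>y. y \<in> Y \<Longrightarrow> Nb y \<subseteq> V"
    and sum: "(\<Sum>y\<in>Y. real (card (Nb y))) \<ge> \<eta> * N * card V"
  shows "\<exists>S. S \<subseteq> V \<and> card S = t \<and> real (card {y\<in>Y. S \<subseteq> Nb y}) \<ge> \<eta> / 2 * (\<eta> / (2 * real t)) ^ t * N"
proof -
  define n where "n = real (card V)"
  have n0: "n > 0" using assms by (simp add: n_def card_gt_0_iff)
  \<comment> \<open>The threshold is half the average: the \<open>y\<close> below it contribute at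
    most half of the sum, so the rest must number at least \<open>\<eta> / 2 * N\<close>.\<close>
  define D where "D = {y\<in>Y. real (card (Nb y)) \<ge> \<eta> * n / 2}"
  have fD: "finite D" "D \<subseteq> Y" using Y by (auto simp: D_def)
  have fN: "finite (Nb y)" if "y \<in> Y" for y using R[OF that] V finite_subset by blast
  have cN: "real (card (Nb y)) \<le> n" if "y \<in> Y" for y
    using R[OF that] V unfolding n_def by (simp add: card_mono)
  have "\<eta> * N * n \<le> (\<Sum>y\<in>Y. real (card (Nb y)))"
    using sum by (simp add: n_def)
  also have "\<dots> = (\<Sum>y\<in>D. real (card (Nb y))) + (\<Sum>y\<in>Y - D. real (card (Nb y)))"
    using fD Y by (subst sum.subset_diff[of D]) auto
  also have "\<dots> \<le> (\<Sum>y\<in>D. n) + (\<Sum>y\<in>Y - D. \<eta> * n / 2)"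
    using fD cN by (intro add_mono sum_mono) (auto simp: D_def)
  also have "(\<Sum>y\<in>Y - D. \<eta> * n / 2) \<le> (\<Sum>y\<in>Y. \<eta> * n / 2)"
    using Y \<eta> n0 by (intro sum_mono2) auto
  finally have "\<eta> * N * n \<le> real (card D) * n + N * (\<eta> * n / 2)"
    using Y by simp
  then have "(\<eta> / 2 * N) * n \<le> real (card D) * n" by (simp add: algebra_simps)
  then have cD: "\<eta> / 2 * N \<le> real (card D)" using n0 by simp
  define T where "T = {S. S \<subseteq> V \<and> card S = t}"
  have fT: "finite T" using V by (simp add: T_def)
  have cT: "real (card T) \<le> n ^ t"
  proof (cases "t \<le> card V")
    case True
    have "card T = card V choose t" unfolding T_def using V by (rule n_subsets)
    then have "card T \<le> card V ^ t" using binomial_le_pow[OF True] by simp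
    then show ?thesis unfolding n_def using of_nat_le_iff[of "card T" "card V ^ t", where ?'a=real] by simp
  next
    case False
    then have "T = {}" using card_mono[OF V] by (auto simp: T_def)
    then show ?thesis using n0 by simp
  qed
  have lower: "(\<eta> * n / (2 * real t)) ^ t \<le> real (card {S\<in>T. S \<subseteq> Nb y})" if y: "y \<in> D" for y
  proof -
    have yY: "y \<in> Y" and big: "\<eta> * n / 2 \<le> card (Nb y)" using y by (auto simp: D_def)
    \<comment> \<open>The lower bound on \<open>card V\<close> serves to make
      \<open>t \<le> card (Nb y)\<close>, which the estimate \<open>(m/t)^t \<le> m choose t\<close>
      requires.\<close>
    have "real t \<le> \<eta> * n / 2" using n \<eta> by (simp add: n_def field_simps)
    then have tc: "t \<le> card (Nb y)" using big by linarith
    have "{S\<in>T. S \<subseteq> Nb y} = {S. S \<subseteq> Nb y \<and> card S = t}"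
      using R[OF yY] by (auto simp: T_def)
    then have "card {S\<in>T. S \<subseteq> Nb y} = card (Nb y) choose t"
      using n_subsets[OF fN[OF yY]] by simp
    moreover have "(real (card (Nb y)) / real t) ^ t \<le> real (card (Nb y) choose t)"
      using tc by (rule binomial_ge_n_over_k_pow_k)
    moreover have "(\<eta> * n / (2 * real t)) ^ t \<le> (real (card (Nb y)) / real t) ^ t"
    proof (rule power_mono)
      have "\<eta> * n / 2 / t \<le> real (card (Nb y)) / real t" using big by (rule divide_right_mono) simp
      then show "\<eta> * n / (2 * real t) \<le> real (card (Nb y)) / real t" by simp
      show "0 \<le> \<eta> * n / (2 * real t)" using \<eta> n0 by simp
    qed
    ultimately show ?thesis by linarith
  qed
  have pos: "0 < \<eta> / 2 * N * (\<eta> * n / (2 * real t)) ^ t"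
    using \<eta> N n0 by (cases "t = 0") auto
  have "\<eta> / 2 * N * (\<eta> * n / (2 * real t)) ^ t \<le> real (card D) * (\<eta> * n / (2 * real t)) ^ t"
    using cD \<eta> n0 by (intro mult_right_mono) auto
  also have "\<dots> = (\<Sum>y\<in>D. (\<eta> * n / (2 * real t)) ^ t)" by simp
  also have "\<dots> \<le> (\<Sum>y\<in>D. real (card {S\<in>T. S \<subseteq> Nb y}))"
    by (intro sum_mono lower)
  also have "\<dots> = (\<Sum>S\<in>T. real (card {y\<in>D. S \<subseteq> Nb y}))"
    using sum_multicount_gen[OF fD(1) fT, of "\<lambda>y S. S \<subseteq> Nb y" "\<lambda>S. card {y\<in>D. S \<subseteq> Nb y}"]
    by (simp flip: of_nat_sum)
  finally have *: "\<eta> / 2 * N * (\<eta> * n / (2 * real t)) ^ t \<le> (\<Sum>S\<in>T. real (card {y\<in>D. S \<subseteq> Nb y}))" .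
  have "T \<noteq> {}" using pos * by auto
  moreover have "real (card T) * (\<eta> / 2 * (\<eta> / (2 * real t)) ^ t * N) \<le> (\<Sum>S\<in>T. real (card {y\<in>D. S \<subseteq> Nb y}))"
  proof -
    have "real (card T) * (\<eta> / 2 * (\<eta> / (2 * real t)) ^ t * N) \<le> n ^ t * (\<eta> / 2 * (\<eta> / (2 * real t)) ^ t * N)"
      using cT \<eta> N by (intro mult_right_mono) auto
    also have "\<dots> = \<eta> / 2 * N * (\<eta> * n / (2 * real t)) ^ t"
      by (simp add: power_mult_distrib power_divide)
    finally show ?thesis using * by linarith
  qed
  ultimately obtain S where S: "S \<in> T" "\<eta> / 2 * (\<eta> / (2 * real t)) ^ t * N \<le> real (card {y\<in>D. S \<subseteq> Nb y})"
    using exists_weighted_average[OF fT, of "\<eta> / 2 * (\<eta> / (2 * real t)) ^ t * N"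
        "\<lambda>S. real (card {y\<in>D. S \<subseteq> Nb y})"] by blast
  have "card {y\<in>D. S \<subseteq> Nb y} \<le> card {y\<in>Y. S \<subseteq> Nb y}"
    using Y fD by (intro card_mono) auto
  then have "real (card {y\<in>D. S \<subseteq> Nb y}) \<le> real (card {y\<in>Y. S \<subseteq> Nb y})" by simp
  then have "\<eta> / 2 * (\<eta> / (2 * real t)) ^ t * N \<le> real (card {y\<in>Y. S \<subseteq> Nb y})"
    using S(2) by linarith
  moreover have "S \<subseteq> V" "card S = t" using S(1) by (auto simp: T_def)
  ultimately show ?thesis by (intro exI[of _ S] conjI) auto
qed

text \<open>An ordered form of the complete \<open>k\<close>-partite \<open>k\<close>-uniform
  hypergraph with sides of size \<open>t\<close>. Disjointness of the sides is not part of it; in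
  \<open>box_embedding\<close> vertices of different sides are adjacent and hence distinct.\<close>

definition contains_box :: "nat \<Rightarrow> nat \<Rightarrow> 'a set \<Rightarrow> 'a list set \<Rightarrow> bool" where
  "contains_box k t V R \<longleftrightarrow> (\<exists>A. (\<forall>i<k. A i \<subseteq> V \<and> card (A i) = t) \<and>
     (\<forall>xs. length xs = k \<and> (\<forall>i<k. xs ! i \<in> A i) \<longrightarrow> xs \<in> R))"

text \<open>Induction on the arity: heads and tails of the tuples form a bipartite graph of density
  at least \<open>\<eta>\<close>. The averaging step finds \<open>t\<close> heads \<open>S\<close>
  shared by a positive proportion \<open>\<eta>'\<close> of all tails, and a box among those tails
  becomes a box in \<open>R\<close> when \<open>S\<close> is put in front of it.\<close>

lemma box_supersaturation:
  fixes \<eta> :: real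
  assumes "0 < \<eta>"
  shows "\<exists>n0. \<forall>(V :: 'a set) R. finite V \<longrightarrow> card V \<ge> n0 \<longrightarrow> R \<subseteq> {xs. set xs \<subseteq> V \<and> length xs = k}
     \<longrightarrow> real (card R) \<ge> \<eta> * real (card V) ^ k \<longrightarrow> contains_box k t V R"
  using assms
proof (induction k arbitrary: \<eta>)
  case 0
  have R: "[] \<in> R" if "R \<subseteq> {[]}" "real (card R) \<ge> \<eta>" for R :: "'a list set"
  proof -
    have "R \<noteq> {}" using that(2) 0 by auto
    with that(1) show ?thesis by auto
  qed
  show ?case
  proof (intro exI[of _ 0] allI impI)
    fix V :: "'a set" and R
    assume "R \<subseteq> {xs. set xs \<subseteq> V \<and> length xs = 0}" "\<eta> * real (card V) ^ 0 \<le> real (card R)"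
    then have "[] \<in> R" by (intro R) auto
    then show "contains_box 0 t V R" by (simp add: contains_box_def)
  qed
next
  case (Suc k)
  define \<eta>' where "\<eta>' = \<eta> / 2 * (\<eta> / (2 * real t)) ^ t"
  have "\<eta>' > 0" using Suc.prems by (cases "t = 0") (auto simp: \<eta>'_def)
  from Suc.IH[OF this] obtain n0 where n0: "\<forall>(V :: 'a set) R. finite V \<longrightarrow> card V \<ge> n0 \<longrightarrow>
     R \<subseteq> {xs. set xs \<subseteq> V \<and> length xs = k} \<longrightarrow> real (card R) \<ge> \<eta>' * real (card V) ^ k \<longrightarrow> contains_box k t V R"
    by (elim exE)
  show ?case
  proof (intro exI[of _ "max 1 (max n0 (nat \<lceil>2 * real t / \<eta>\<rceil>))"] allI impI)
    fix V :: "'a set" and R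
    assume V: "finite V" and cV: "max 1 (max n0 (nat \<lceil>2 * real t / \<eta>\<rceil>)) \<le> card V"
      and R: "R \<subseteq> {xs. set xs \<subseteq> V \<and> length xs = Suc k}" and cR: "\<eta> * real (card V) ^ Suc k \<le> real (card R)"
    define Y where "Y = {xs. set xs \<subseteq> V \<and> length xs = k}"
    define Nb where "Nb y = {x\<in>V. x # y \<in> R}" for y
    have Y: "finite Y" "real (card Y) = real (card V) ^ k"
      unfolding Y_def using V by (auto simp: finite_lists_length_eq card_lists_length_eq)
    have "R = (\<lambda>(y,x). x # y) ` (SIGMA y:Y. Nb y)" (is "_ = ?h ` _")
    proof (intro equalityI subsetI)
      fix xs assume xs: "xs \<in> R"
      then obtain x y where "xs = x # y" using R by (cases xs) auto
      then show "xs \<in> ?h ` (SIGMA y:Y. Nb y)" using xs R by (force simp: Nb_def Y_def)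
    qed (auto simp: Nb_def)
    moreover have "inj_on ?h (SIGMA y:Y. Nb y)" by (auto simp: inj_on_def)
    ultimately have "card R = card (SIGMA y:Y. Nb y)" by (metis card_image)
    also have "\<dots> = (\<Sum>y\<in>Y. card (Nb y))"
      using Y V by (intro card_SigmaI) (auto simp: Nb_def)
    finally have "real (card R) = (\<Sum>y\<in>Y. real (card (Nb y)))" by simp
    then have "\<exists>S. S \<subseteq> V \<and> card S = t \<and> real (card {y\<in>Y. S \<subseteq> Nb y}) \<ge> \<eta> / 2 * (\<eta> / (2 * real t)) ^ t * real (card V) ^ k"
      using V Y cR cV Suc.prems by (intro exists_common_box_step) (auto simp: Nb_def mult_ac)
    then obtain S where S: "S \<subseteq> V" "card S = t" "\<eta>' * real (card V) ^ k \<le> real (card {y\<in>Y. S \<subseteq> Nb y})"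
      by (auto simp: \<eta>'_def)
    have "contains_box k t V {y\<in>Y. S \<subseteq> Nb y}"
      using n0[rule_format, OF V _ _ S(3)] cV unfolding Y_def by auto
    then obtain A where A0: "(\<forall>i<k. A i \<subseteq> V \<and> card (A i) = t) \<and>
        (\<forall>xs. length xs = k \<and> (\<forall>i<k. xs ! i \<in> A i) \<longrightarrow> xs \<in> {y\<in>Y. S \<subseteq> Nb y})"
      unfolding contains_box_def by (elim exE)
    have A: "\<And>i. i < k \<Longrightarrow> A i \<subseteq> V \<and> card (A i) = t"
        "\<And>xs. length xs = k \<Longrightarrow> (\<forall>i<k. xs ! i \<in> A i) \<Longrightarrow> xs \<in> {y\<in>Y. S \<subseteq> Nb y}"
      using A0 by simp_all
    show "contains_box (Suc k) t V R"
      unfolding contains_box_def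
    proof (intro exI[of _ "case_nat S A"] conjI allI impI; (elim conjE)?)
      fix i assume "i < Suc k"
      then show "case_nat S A i \<subseteq> V" "card (case_nat S A i) = t" using S A by (auto split: nat.split)
    next
      fix xs assume xs: "length xs = Suc k" "\<forall>i<Suc k. xs ! i \<in> case_nat S A i"
      then obtain x y where xy: "xs = x # y" by (cases xs) auto
      have "x \<in> S" using xs(2)[rule_format, of 0] xy by simp
      moreover have "\<forall>i<k. y ! i \<in> A i" using xs(2)[rule_format, of "Suc i" for i] xy by auto
      then have "S \<subseteq> Nb y" using A(2)[of y] xs xy by auto
      ultimately show "xs \<in> R" using xy by (auto simp: Nb_def)
    qed
  qed
qed

section \<open>Isomorphism and colourings\<close>

lemma graph_iso_sym:
  assumes "graph_iso G H" "simple_graph G"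
  shows "graph_iso H G"
proof -
  obtain f where f: "bij_betw f (verts G) (verts H)" "(\<lambda>e. f ` e) ` edges G = edges H"
    using assms(1) by (auto simp: graph_iso_def)
  define h where "h = inv_into (verts G) f"
  have "h ` f ` e = e" if "e \<in> edges G" for e
    using that assms(2) f(1) unfolding h_def
    by (intro inv_into_image_cancel) (auto simp: simple_graph_def bij_betw_def)
  then have "(\<lambda>e. h ` e) ` edges H = edges G"
    unfolding f(2)[symmetric] by (force simp: image_image)
  moreover have "bij_betw h (verts H) (verts G)"
    unfolding h_def using f(1) by (rule bij_betw_inv_into)
  ultimately show ?thesis unfolding graph_iso_def by blast
qed

text \<open>An injective numbering of the finite vertex set is a proper colouring, so the
  \<open>LEAST\<close> in the definition is attained.\<close>

lemma proper_colouring_chromatic_number: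
  assumes "simple_graph F"
  shows "\<exists>c. proper_colouring F (chromatic_number F) c"
proof -
  have "finite (verts F)" using assms by (simp add: simple_graph_def)
  then obtain f and m :: nat where f: "f ` verts F = {i. i < m}" "inj_on f (verts F)"
    using finite_imp_inj_to_nat_seg by blast
  have "proper_colouring F m f"
    unfolding proper_colouring_def
  proof (intro conjI ballI allI impI)
    fix v assume "v \<in> verts F"
    then show "f v < m" using f(1) by blast
  next
    fix u v assume uv: "{u, v} \<in> edges F"
    then have "{u, v} \<subseteq> verts F" "card {u, v} = 2" using assms unfolding simple_graph_def by blast+
    then have "u \<in> verts F" "v \<in> verts F" "u \<noteq> v" by auto
    then show "f u \<noteq> f v" using f(2) by (auto dest: inj_onD)
  qed
  then have "\<exists>c. proper_colouring F m c" by (rule exI[of "proper_colouring F m" f])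
  then show ?thesis unfolding chromatic_number_def by (rule LeastI[of "\<lambda>k. \<exists>c. proper_colouring F k c"])
qed

lemma proper_colouring_iso:
  assumes "graph_iso F S" "proper_colouring S k c"
  shows "\<exists>c'. proper_colouring F k c'"
proof -
  obtain f where f: "bij_betw f (verts F) (verts S)" "(\<lambda>e. f ` e) ` edges F = edges S"
    using assms(1) by (auto simp: graph_iso_def)
  have "proper_colouring F k (c \<circ> f)"
    unfolding proper_colouring_def
  proof (intro conjI ballI allI impI)
    fix v assume "v \<in> verts F"
    then show "(c \<circ> f) v < k"
      using assms(2) f(1) by (auto simp: proper_colouring_def bij_betw_def)
  next
    fix u v assume "{u, v} \<in> edges F"
    then have "f ` {u, v} \<in> edges S" using f(2) by blast
    then show "(c \<circ> f) u \<noteq> (c \<circ> f) v" using assms(2) by (simp add: proper_colouring_def)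
  qed
  then show ?thesis by (rule exI[of "proper_colouring F k" "c \<circ> f"])
qed

text \<open>A copy of \<open>F\<close> in \<open>G\<close> would inherit the
  \<open>k\<close>-colouring. This is what makes the Turan graph a competitor in
  \<open>ex_turan\<close>.\<close>

lemma free_of_colourable:
  assumes "simple_graph G" "proper_colouring G k c" "k < chromatic_number F"
  shows "free_of F G"
  unfolding free_of_def
proof
  assume "\<exists>S. subgraph S G \<and> graph_iso S F"
  then obtain S where S: "subgraph S G" "graph_iso S F" by blast
  have "proper_colouring S k c"
    using assms(2) S(1) by (auto simp: proper_colouring_def subgraph_def)
  moreover have "simple_graph S" using S(1) by (simp add: subgraph_def)
  with S(2) have "graph_iso F S" by (rule graph_iso_sym)
  ultimately have "\<exists>c'. proper_colouring F k c'" by (intro proper_colouring_iso)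
  then obtain c' where "proper_colouring F k c'" by (elim exE)
  then have "\<exists>c. proper_colouring F k c" by (rule exI[of "proper_colouring F k" c'])
  then have "chromatic_number F \<le> k"
    unfolding chromatic_number_def by (rule Least_le[of "\<lambda>k. \<exists>c. proper_colouring F k c"])
  with assms(3) show False by simp
qed

section \<open>Ordered cliques and the embedding of a colourable graph\<close>

context finite_graph
begin

text \<open>Labelled cliques: a relation to which the box theorem applies, and, for nonempty
  \<open>V\<close>, a set of exactly \<open>cdens s * n^s\<close> elements.\<close>

definition clique_lists :: "nat \<Rightarrow> 'a list set" where
  "clique_lists s = {xs. distinct xs \<and> set xs \<in> cliques V s}"

lemma clique_lists_subset: "clique_lists s \<subseteq> {xs. set xs \<subseteq> V \<and> length xs = s}"
  by (auto simp: clique_lists_def cliques_def distinct_card)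

lemma finite_clique_lists: "finite (clique_lists s)"
  by (rule finite_subset[OF clique_lists_subset]) (simp add: finite_lists_length_eq)

lemma card_cliques_le_clique_lists: "card (cliques V s) \<le> card (clique_lists s)"
proof -
  have "cliques V s \<subseteq> set ` clique_lists s"
  proof
    fix Q assume Q: "Q \<in> cliques V s"
    then have "finite Q" by (rule finite_clique) simp
    then obtain xs where "set xs = Q" "distinct xs" using finite_distinct_list by blast
    then show "Q \<in> set ` clique_lists s" using Q by (auto simp: clique_lists_def)
  qed
  then show ?thesis using finite_clique_lists by (meson surj_card_le)
qed

text \<open>Each colour class of \<open>F\<close> is mapped injectively into its own side of the
  box. A side of size \<open>Suc (card (verts F))\<close> has room for all of \<open>F\<close>, and
  it is nonempty even when \<open>F\<close> has no vertices, so that tuples in the box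
  exist.\<close>

lemma box_embedding:
  fixes F :: "'b graph"
  assumes F: "simple_graph F" and col: "proper_colouring F k c"
    and box: "contains_box k (Suc (card (verts F))) V (clique_lists k)"
  shows "\<not> free_of F G"
proof -
  let ?t = "Suc (card (verts F))"
  obtain A where "(\<forall>i<k. A i \<subseteq> V \<and> card (A i) = ?t) \<and>
        (\<forall>xs. length xs = k \<and> (\<forall>i<k. xs ! i \<in> A i) \<longrightarrow> xs \<in> clique_lists k)"
    using box unfolding contains_box_def by (elim exE)
  then have A: "\<And>i. i < k \<Longrightarrow> A i \<subseteq> V" "\<And>i. i < k \<Longrightarrow> card (A i) = ?t"
        "\<And>xs. length xs = k \<Longrightarrow> (\<forall>i<k. xs ! i \<in> A i) \<Longrightarrow> xs \<in> clique_lists k" by simp_all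
  have finA: "finite (A i)" if "i < k" for i using A(2)[OF that] card.infinite by fastforce
  have ne: "\<exists>a. i < k \<longrightarrow> a \<in> A i" for i
    using A(2)[of i] by (cases "A i = {}") auto
  then obtain a where a: "\<And>i. i < k \<Longrightarrow> a i \<in> A i" by metis
  have adjA: "adj x y" if "i < k" "j < k" "i \<noteq> j" "x \<in> A i" "y \<in> A j" for x y i j
  proof -
    \<comment> \<open>Membership in the box concerns full tuples, so the coordinates other than
      \<open>i\<close> and \<open>j\<close> are filled with fixed representatives
      \<open>a\<close>.\<close>
    define xs where "xs = map (a(i := x, j := y)) [0..<k]"
    have "length xs = k" "\<forall>l<k. xs ! l \<in> A l" using that a by (auto simp: xs_def)
    then have "xs \<in> clique_lists k" by (rule A(3))
    moreover have "xs ! i = x" "xs ! j = y" using that by (auto simp: xs_def)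
    ultimately have "x \<in> set xs" "y \<in> set xs" "x \<noteq> y" "set xs \<in> cliques V k"
      using that \<open>length xs = k\<close> by (auto simp: clique_lists_def nth_eq_iff_index_eq)
    then show ?thesis by (auto simp: cliques_def)
  qed
  have finF: "finite (verts F)" using F by (simp add: simple_graph_def)
  have "\<exists>g. i < k \<longrightarrow> g ` verts F \<subseteq> A i \<and> inj_on g (verts F)" for i
  proof (cases "i < k")
    case True
    then show ?thesis using card_le_inj[OF finF finA[OF True]] A(2)[OF True] by auto
  qed auto
  then obtain g where g: "\<And>i. i < k \<Longrightarrow> g i ` verts F \<subseteq> A i" "\<And>i. i < k \<Longrightarrow> inj_on (g i) (verts F)"
    by metis
  define f where "f v = g (c v) v" for v
  have ck: "c v < k" if "v \<in> verts F" for v using col that by (simp add: proper_colouring_def)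
  have fA: "f v \<in> A (c v)" if "v \<in> verts F" for v
    using g(1)[OF ck[OF that]] that by (auto simp: f_def)
  have inj: "inj_on f (verts F)"
  proof (rule inj_onI)
    fix u v assume uv: "u \<in> verts F" "v \<in> verts F" "f u = f v"
    have "c u = c v"
    proof (rule ccontr)
      assume "c u \<noteq> c v"
      then have "adj (f u) (f v)" using uv(1,2) ck fA by (intro adjA[of "c u" "c v"]) auto
      then show False using uv(3) by simp
    qed
    then show "u = v" using uv g(2)[OF ck[OF uv(1)]] by (auto simp: f_def dest: inj_onD)
  qed
  define S where "S = \<lparr>verts = f ` verts F, edges = (\<lambda>e. f ` e) ` edges F\<rparr>"
  have edge: "e \<subseteq> verts F \<and> card e = 2" if "e \<in> edges F" for e using F that by (simp add: simple_graph_def)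
  have sS: "simple_graph S"
    unfolding simple_graph_def S_def using finF edge inj
    by (auto simp: card_image inj_on_subset)
  have "edges S \<subseteq> edges G"
  proof
    fix e' assume "e' \<in> edges S"
    then obtain e where e: "e \<in> edges F" "e' = f ` e" by (auto simp: S_def)
    obtain u v where uv: "e = {u, v}" using edge[OF e(1)] by (auto simp: card_2_iff)
    then have "c u \<noteq> c v" "u \<in> verts F" "v \<in> verts F"
      using col e edge[OF e(1)] by (auto simp: proper_colouring_def)
    then have "adj (f u) (f v)" using ck fA by (intro adjA[of "c u" "c v"]) auto
    then show "e' \<in> edges G" using e uv by simp
  qed
  moreover have "verts S \<subseteq> V" using fA A(1) ck by (fastforce simp: S_def)
  ultimately have "subgraph S G" using sS by (simp add: subgraph_def)
  moreover have "graph_iso F S"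
    unfolding graph_iso_def S_def using inj by (auto simp: bij_betw_def)
  then have "graph_iso S F" by (rule graph_iso_sym[OF _ F])
  ultimately show ?thesis by (auto simp: free_of_def)
qed

end

lemma free_of_cdens_le:
  fixes F :: "'b graph"
  assumes F: "simple_graph F" and \<eta>: "0 < \<eta>"
  shows "\<exists>n0. \<forall>G :: 'a graph. simple_graph G \<longrightarrow> free_of F G \<longrightarrow> card (verts G) \<ge> n0 \<longrightarrow>
           finite_graph.cdens G (chromatic_number F) \<le> \<eta>"
proof -
  let ?k = "chromatic_number F"
  obtain c where c: "proper_colouring F ?k c" using proper_colouring_chromatic_number[OF F] ..
  \<comment> \<open>The factorial is the price for comparing unordered cliques directly with lists,
    through the crude bound \<open>card_cliques_le_clique_lists\<close>.\<close>
  have "0 < \<eta> / fact ?k" using \<eta> by simp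
  from box_supersaturation[OF this, of ?k "Suc (card (verts F))"]
  obtain n0 where n0: "\<forall>(V :: 'a set) R. finite V \<longrightarrow> card V \<ge> n0 \<longrightarrow> R \<subseteq> {xs. set xs \<subseteq> V \<and> length xs = ?k}
     \<longrightarrow> real (card R) \<ge> \<eta> / fact ?k * real (card V) ^ ?k \<longrightarrow> contains_box ?k (Suc (card (verts F))) V R"
    by (elim exE)
  show ?thesis
  proof (intro exI[of _ "max 1 n0"] allI impI, rule ccontr)
    fix G :: "'a graph"
    assume G: "simple_graph G" "free_of F G" "max 1 n0 \<le> card (verts G)"
      and "\<not> finite_graph.cdens G ?k \<le> \<eta>"
    interpret finite_graph G using G(1) by unfold_locales
    have "\<eta> < cdens ?k" using \<open>\<not> _\<close> by simp
    moreover have "V \<noteq> {}" using G(3) by auto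
    ultimately have "\<eta> / fact ?k * real (card V) ^ ?k \<le> real (card (cliques V ?k))"
      by (simp add: card_cliques_cdens mult_right_mono divide_right_mono)
    also have "\<dots> \<le> real (card (clique_lists ?k))" using card_cliques_le_clique_lists by simp
    finally have "contains_box ?k (Suc (card (verts F))) V (clique_lists ?k)"
      using n0[rule_format, OF finV _ clique_lists_subset] G(3) by simp
    then show False using box_embedding[OF F c] G(2) by blast
  qed
qed

section \<open>Clique densities\<close>

text \<open>Isolates what the next argument uses about a graph. Working with real sequences shows
  that the constants obtained are uniform over all graphs.\<close>

definition moon_moser_seq :: "(nat \<Rightarrow> real) \<Rightarrow> bool" where
  "moon_moser_seq t \<longleftrightarrow> (\<forall>s. 0 \<le> t s \<and> t s \<le> 1 \<and>
     real (Suc s) * t (Suc s) ^ 2 \<le> t s * (t (Suc s) + s * t (s + 2)))"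

lemma (in finite_graph) moon_moser_seq_cdens: "moon_moser_seq cdens"
  using cdens_le_1 cdens_nonneg cdens_moon_moser unfolding moon_moser_seq_def by blast

text \<open>Downward induction from \<open>s = r\<close>, where the claim is just
  \<open>t (Suc r) \<le> c\<close>. Inserting the bound on \<open>t (s + 2)\<close> into Moon-Moser
  gives \<open>y^2 \<le> (1 - s/r) * x * y + c^2\<close> for \<open>x = t s\<close> and
  \<open>y = t (Suc s)\<close>, which is then turned into a linear bound with additive
  error.\<close>

lemma moon_moser_chain:
  assumes "0 < c" "j < r"
  shows "\<exists>\<eta>>0. \<forall>t. moon_moser_seq t \<longrightarrow> t (Suc r) \<le> \<eta> \<longrightarrow>
           (\<forall>s. r - j \<le> s \<and> s \<le> r \<longrightarrow> t (Suc s) \<le> (1 - s / r) * t s + c)"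
  using assms
proof (induction j arbitrary: c)
  case 0
  then show ?case by (intro exI[of _ c]) auto
next
  case (Suc j)
  \<comment> \<open>The square absorbs the loss of a square root in the step from \<open>y^2\<close>
    to \<open>y\<close>; the minimum with \<open>c\<close> keeps the inequalities already obtained
    for larger \<open>s\<close>.\<close>
  define c' where "c' = min c (c^2)"
  have c': "0 < c'" "c' \<le> c" "c' \<le> c^2" using Suc.prems by (auto simp: c'_def)
  have "j < r" using Suc.prems by simp
  from Suc.IH[OF c'(1) this] obtain \<eta> where \<eta>: "\<eta> > 0" "\<forall>t. moon_moser_seq t \<longrightarrow> t (Suc r) \<le> \<eta> \<longrightarrow>
           (\<forall>s. r - j \<le> s \<and> s \<le> r \<longrightarrow> t (Suc s) \<le> (1 - s / r) * t s + c')"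
    by (elim exE conjE)
  have "t (Suc s) \<le> (1 - s / r) * t s + c"
    if t: "moon_moser_seq t" "t (Suc r) \<le> \<eta>" and s: "r - Suc j \<le> s" "s \<le> r" for t s
  proof (cases "r - j \<le> s")
    case True
    then show ?thesis using \<eta>(2)[rule_format, OF t, of s] s c' by linarith
  next
    case False
    then have s': "r - j \<le> Suc s" "Suc s \<le> r" using s Suc.prems by auto
    define x y z where "x = t s" "y = t (Suc s)" "z = t (s + 2)"
    have xyz: "0 \<le> x" "x \<le> 1" "0 \<le> y" "y \<le> 1"
      and mm: "real (Suc s) * y^2 \<le> x * (y + s * z)"
      using t(1) unfolding moon_moser_seq_def x_y_z_def by blast+
    have z: "z \<le> (1 - Suc s / r) * y + c'"
      using \<eta>(2)[rule_format, OF t, of "Suc s"] s' by (simp add: x_y_z_def)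
    have r: "real r > 0" using s' by simp
    have "s * z \<le> s * ((1 - Suc s / r) * y + c')" using z by (rule mult_left_mono) simp
    then have "x * (y + s * z) \<le> x * (y + s * ((1 - Suc s / r) * y + c'))"
      by (rule mult_left_mono[OF add_left_mono xyz(1)])
    \<comment> \<open>The identity \<open>1 + s * (1 - (s+1)/r) = (s+1) * (1 - s/r)\<close>
      reproduces the Turan ratio one level down.\<close>
    also have "\<dots> = Suc s * ((1 - s / r) * x * y) + s * (x * c')"
      using r by (simp add: field_simps)
    also have "s * (x * c') \<le> s * (1 * c^2)"
      using xyz c' by (intro mult_left_mono mult_mono) auto
    also have "s * (1 * c^2) \<le> Suc s * c^2" by (simp add: mult_right_mono)
    finally have "real (Suc s) * y^2 \<le> Suc s * ((1 - s / r) * x * y + c^2)"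
      using mm by (simp add: algebra_simps)
    then have y: "y * y \<le> (1 - s / r) * x * y + c^2"
      by (simp add: power2_eq_square del: of_nat_Suc)
    have "y \<le> (1 - s / r) * x + c"
    proof (rule ccontr)
      assume *: "\<not> ?thesis"
      have "0 \<le> (1 - s / r) * x" using xyz r s by simp
      \<comment> \<open>If the claim fails, then both \<open>y\<close> and
        \<open>y - (1 - s/r) * x\<close> exceed \<open>c\<close>.\<close>
      then have "c * c < y * (y - (1 - s / r) * x)"
        using * Suc.prems by (intro mult_strict_mono) auto
      then show False using y by (simp add: algebra_simps power2_eq_square)
    qed
    then show ?thesis by (simp add: x_y_z_def)
  qed
  then show ?case using \<eta>(1) by blast
qed

lemma cdens_chain:
  assumes "0 < c" "0 < r"
  shows "\<exists>\<eta>>0. \<forall>G :: 'a graph. simple_graph G \<longrightarrow> finite_graph.cdens G (Suc r) \<le> \<eta> \<longrightarrow>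
           (\<forall>s\<in>{1..r}. finite_graph.cdens G (Suc s) \<le> (1 - s / r) * finite_graph.cdens G s + c)"
proof -
  \<comment> \<open>With \<open>j = r - 1\<close> the range begins at \<open>s = 1\<close>, whose
    density \<open>cdens 1 = 1\<close> later starts the chain.\<close>
  have "r - 1 < r" using assms by simp
  from moon_moser_chain[OF assms(1) this] obtain \<eta> where \<eta>: "\<eta> > 0" "\<forall>t. moon_moser_seq t \<longrightarrow> t (Suc r) \<le> \<eta> \<longrightarrow>
           (\<forall>s. r - (r - 1) \<le> s \<and> s \<le> r \<longrightarrow> t (Suc s) \<le> (1 - s / r) * t s + c)"
    by (elim exE conjE)
  show ?thesis
  proof (intro exI[of _ \<eta>] conjI allI impI ballI)
    fix G :: "'a graph" and s
    assume "simple_graph G" and *: "finite_graph.cdens G (Suc r) \<le> \<eta>" "s \<in> {1..r}"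
    then interpret finite_graph G by unfold_locales
    show "cdens (Suc s) \<le> (1 - s / r) * cdens s + c"
      using \<eta>(2)[rule_format, OF moon_moser_seq_cdens *(1), of s] *(2) by simp
  qed (rule \<eta>(1))
qed

section \<open>Counting four-cycles\<close>

definition cycle4 :: "'a \<Rightarrow> 'a \<Rightarrow> 'a \<Rightarrow> 'a \<Rightarrow> 'a graph" where
  "cycle4 a b c d = \<lparr>verts = {a, b, c, d}, edges = {{a, b}, {b, c}, {c, d}, {d, a}}\<rparr>"

text \<open>The eight tuples are the dihedral symmetries of the square. The oriented edge
  \<open>(a', b')\<close> can be chosen in eight ways; then \<open>c'\<close> must be the other
  neighbour of \<open>b'\<close>, and \<open>d'\<close> the other neighbour of
  \<open>a'\<close>.\<close>

lemma cycle4_relabelling: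
  assumes "distinct [a, b, c, d]" "a' \<noteq> c'" "b' \<noteq> d'"
    and "{a', b'} \<in> {{a, b}, {b, c}, {c, d}, {d, a}}" "{b', c'} \<in> {{a, b}, {b, c}, {c, d}, {d, a}}"
    and "{d', a'} \<in> {{a, b}, {b, c}, {c, d}, {d, a}}"
  shows "(a', b', c', d') \<in> {(a, b, c, d), (b, c, d, a), (c, d, a, b), (d, a, b, c),
           (a, d, c, b), (d, c, b, a), (c, b, a, d), (b, a, d, c)}"
proof -
  have "(a', b') \<in> {(a, b), (b, c), (c, d), (d, a), (b, a), (c, b), (d, c), (a, d)}"
    using assms(4) by (auto simp: doubleton_eq_iff)
  then show ?thesis
    using assms(1,2,3,5,6) by (elim insertE; simp add: doubleton_eq_iff) blast+
qed

lemma cycle4_eq_iff: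
  assumes "distinct [a, b, c, d]" "distinct [a', b', c', d']"
  shows "cycle4 a' b' c' d' = cycle4 a b c d \<longleftrightarrow>
    (a', b', c', d') \<in> {(a, b, c, d), (b, c, d, a), (c, d, a, b), (d, a, b, c),
           (a, d, c, b), (d, c, b, a), (c, b, a, d), (b, a, d, c)}"
proof
  assume "cycle4 a' b' c' d' = cycle4 a b c d"
  then have E: "{{a', b'}, {b', c'}, {c', d'}, {d', a'}} = {{a, b}, {b, c}, {c, d}, {d, a}}"
    by (simp add: cycle4_def)
  show "(a', b', c', d') \<in> {(a, b, c, d), (b, c, d, a), (c, d, a, b), (d, a, b, c),
           (a, d, c, b), (d, c, b, a), (c, b, a, d), (b, a, d, c)}"
    by (rule cycle4_relabelling[OF assms(1)]; (unfold E[symmetric])?) (use assms(2) in auto)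
next
  assume "(a', b', c', d') \<in> {(a, b, c, d), (b, c, d, a), (c, d, a, b), (d, a, b, c),
           (a, d, c, b), (d, c, b, a), (c, b, a, d), (b, a, d, c)}"
  then show "cycle4 a' b' c' d' = cycle4 a b c d"
    by (elim insertE) (auto simp: cycle4_def insert_commute)
qed

lemma simple_graph_C4: "simple_graph C4"
  by (auto simp: simple_graph_def C4_def)

lemma graph_iso_C4_iff:
  assumes "simple_graph S"
  shows "graph_iso S C4 \<longleftrightarrow> (\<exists>a b c d. distinct [a, b, c, d] \<and> S = cycle4 a b c d)"
proof
  assume "graph_iso S C4"
  then have "graph_iso C4 S" by (rule graph_iso_sym[OF _ assms])
  then obtain f where f: "bij_betw f (verts C4) (verts S)" "(\<lambda>e. f ` e) ` edges C4 = edges S"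
    by (auto simp: graph_iso_def)
  have "verts S = {f 0, f 1, f 2, f 3}" using f(1) by (auto simp: bij_betw_def C4_def)
  moreover have "edges S = {{f 0, f 1}, {f 1, f 2}, {f 2, f 3}, {f 3, f 0}}"
    using f(2) by (auto simp: C4_def)
  ultimately have "S = cycle4 (f 0) (f 1) (f 2) (f 3)" by (simp add: cycle4_def)
  moreover have "distinct [f 0, f 1, f 2, f 3]"
    using f(1) by (auto simp: bij_betw_def C4_def inj_on_def)
  ultimately show "\<exists>a b c d. distinct [a, b, c, d] \<and> S = cycle4 a b c d" by blast
next
  assume "\<exists>a b c d. distinct [a, b, c, d] \<and> S = cycle4 a b c d"
  then obtain a b c d where S: "distinct [a, b, c, d]" "S = cycle4 a b c d" by blast
  define f :: "nat \<Rightarrow> 'a" where "f i = [a, b, c, d] ! i" for i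
  have f: "f 0 = a" "f 1 = b" "f 2 = c" "f 3 = d"
    by (simp_all add: f_def numeral_2_eq_2 numeral_3_eq_3)
  have "bij_betw f (verts C4) (verts S)"
    using S f by (auto simp: bij_betw_def C4_def cycle4_def inj_on_def)
  moreover have "(\<lambda>e. f ` e) ` edges C4 = edges S"
    using S f by (simp add: C4_def cycle4_def)
  ultimately have "graph_iso C4 S" unfolding graph_iso_def by blast
  then show "graph_iso S C4" by (rule graph_iso_sym[OF _ simple_graph_C4])
qed

context finite_graph
begin

text \<open>Closed walks of length four, in which opposite vertices may coincide. They are easier to
  count than genuine cycles and exceed them by at most \<open>2 * n^3\<close>, which is negligible
  against \<open>n^4\<close>.\<close>

definition C4_homs :: "('a \<times> 'a \<times> 'a \<times> 'a) set" where
  "C4_homs = {(a, b, c, d). adj a b \<and> adj b c \<and> adj c d \<and> adj d a}"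

definition C4_embeddings :: "('a \<times> 'a \<times> 'a \<times> 'a) set" where
  "C4_embeddings = {(a, b, c, d). (a, b, c, d) \<in> C4_homs \<and> a \<noteq> c \<and> b \<noteq> d}"

lemma C4_homs_subset: "C4_homs \<subseteq> V \<times> V \<times> V \<times> V"
  using adj_V by (auto simp: C4_homs_def)

lemma finite_C4_homs: "finite C4_homs"
  using C4_homs_subset by (rule finite_subset) simp

lemma C4_embeddings_subset: "C4_embeddings \<subseteq> C4_homs"
  by (auto simp: C4_embeddings_def)

lemma finite_C4_embeddings: "finite C4_embeddings"
  using C4_embeddings_subset finite_C4_homs by (rule finite_subset)

lemma C4_embeddings_iff:
  "(a, b, c, d) \<in> C4_embeddings \<longleftrightarrow> distinct [a, b, c, d] \<and> subgraph (cycle4 a b c d) G"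
proof -
  have "a \<noteq> b \<and> a \<in> V \<and> b \<in> V" if "adj a b" for a b using adj_V[OF that] that by auto
  then show ?thesis
    by (auto simp: C4_embeddings_def C4_homs_def subgraph_def simple_graph_def cycle4_def)
qed

text \<open>Every copy is the image of exactly eight labelled cycles, one for each automorphism of
  the square.\<close>

lemma num_copies_C4: "8 * num_copies C4 G = card C4_embeddings"
proof -
  let ?h = "\<lambda>(a, b, c, d). cycle4 a b c d"
  have copies: "{S. subgraph S G \<and> graph_iso S C4} = ?h ` C4_embeddings"
  proof (intro equalityI subsetI)
    fix S assume "S \<in> {S. subgraph S G \<and> graph_iso S C4}"
    then have S: "subgraph S G" "graph_iso S C4" "simple_graph S" by (auto simp: subgraph_def)
    then obtain a b c d where "distinct [a, b, c, d]" "S = cycle4 a b c d"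
      using graph_iso_C4_iff by blast
    then show "S \<in> ?h ` C4_embeddings" using S(1)
      by (intro image_eqI[of _ _ "(a, b, c, d)"]) (auto simp: C4_embeddings_iff)
  next
    fix S assume "S \<in> ?h ` C4_embeddings"
    then obtain a b c d where S: "S = cycle4 a b c d" "(a, b, c, d) \<in> C4_embeddings" by auto
    then have *: "distinct [a, b, c, d]" "subgraph S G" using C4_embeddings_iff by auto
    then have "simple_graph S" by (simp add: subgraph_def)
    then have "graph_iso S C4" using graph_iso_C4_iff[of S] * S by blast
    then show "S \<in> {S. subgraph S G \<and> graph_iso S C4}" using * by simp
  qed
  have fibre: "card {x \<in> C4_embeddings. ?h x = S} = 8" if S_in: "S \<in> ?h ` C4_embeddings" for S
  proof -
    obtain a b c d where S: "S = cycle4 a b c d" and e: "(a, b, c, d) \<in> C4_embeddings"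
      using S_in by auto
    have dist: "distinct [a, b, c, d]" and sub: "subgraph (cycle4 a b c d) G"
      using e C4_embeddings_iff by auto
    let ?E = "{(a, b, c, d), (b, c, d, a), (c, d, a, b), (d, a, b, c),
           (a, d, c, b), (d, c, b, a), (c, b, a, d), (b, a, d, c)}"
    have "{x \<in> C4_embeddings. ?h x = S} = ?E"
    proof (intro equalityI subsetI)
      fix x assume x: "x \<in> {x \<in> C4_embeddings. ?h x = S}"
      obtain a' b' c' d' where xx: "x = (a', b', c', d')" by (cases x)
      with x have "distinct [a', b', c', d']" "cycle4 a' b' c' d' = cycle4 a b c d"
        using C4_embeddings_iff S by auto
      then show "x \<in> ?E" unfolding xx by (subst cycle4_eq_iff[OF dist, symmetric])
    next
      fix x assume x: "x \<in> ?E"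
      obtain a' b' c' d' where xx: "x = (a', b', c', d')" by (cases x)
      have d': "distinct [a', b', c', d']" using x dist unfolding xx by (elim insertE) auto
      have "cycle4 a' b' c' d' = cycle4 a b c d" using x unfolding xx by (subst cycle4_eq_iff[OF dist d'])
      then show "x \<in> {x \<in> C4_embeddings. ?h x = S}"
        using d' sub S xx by (simp add: C4_embeddings_iff)
    qed
    moreover have "card ?E = 8" using dist by simp
    ultimately show ?thesis by simp
  qed
  have "card C4_embeddings = (\<Sum>S\<in>?h ` C4_embeddings. card {x \<in> C4_embeddings. ?h x = S})"
    using sum.image_gen[OF finite_C4_embeddings, of "\<lambda>_. 1::nat" ?h] by simp
  also have "\<dots> = 8 * card (?h ` C4_embeddings)" using fibre by simp
  finally show ?thesis unfolding num_copies_def copies by simp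
qed

lemma card_C4_homs_le: "card C4_homs \<le> card C4_embeddings + 2 * card V ^ 3"
proof -
  let ?D = "(\<lambda>(a, b, d). (a, b, a, d)) ` (V \<times> V \<times> V)" and ?D' = "(\<lambda>(a, b, c). (a, b, c, b)) ` (V \<times> V \<times> V)"
  have "C4_homs \<subseteq> C4_embeddings \<union> (?D \<union> ?D')"
    using C4_homs_subset by (force simp: C4_embeddings_def)
  then have "card C4_homs \<le> card (C4_embeddings \<union> (?D \<union> ?D'))"
    using finite_C4_embeddings by (intro card_mono) auto
  also have "\<dots> \<le> card C4_embeddings + (card ?D + card ?D')"
    by (meson add_left_mono card_Un_le le_trans)
  also have "card ?D \<le> card V ^ 3"
    using card_image_le[of "V \<times> V \<times> V" "\<lambda>(a, b, d). (a, b, a, d)"] by (simp add: power3_eq_cube card_cartesian_product)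
  also have "card ?D' \<le> card V ^ 3"
    using card_image_le[of "V \<times> V \<times> V" "\<lambda>(a, b, c). (a, b, c, b)"] by (simp add: power3_eq_cube card_cartesian_product)
  finally show ?thesis by simp
qed

lemma card_clique_lists: "card (clique_lists s) = fact s * card (cliques V s)"
proof -
  have "clique_lists s = (\<Union>Q\<in>cliques V s. permutations_of_set Q)"
    by (auto simp: clique_lists_def permutations_of_set_def)
  also have "card \<dots> = (\<Sum>Q\<in>cliques V s. card (permutations_of_set Q))"
    by (intro card_UN_disjoint ballI impI) (simp_all, auto simp: permutations_of_set_def)
  also have "\<dots> = (\<Sum>Q\<in>cliques V s. fact s)"
    by (intro sum.cong refl) (use finite_subset[OF _ finV] in \<open>auto simp: cliques_def\<close>)
  finally show ?thesis by simp
qed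

lemma card_clique_lists_cdens:
  "V \<noteq> {} \<Longrightarrow> real (card (clique_lists s)) = cdens s * real (card V) ^ s"
  by (simp add: card_clique_lists cdens_def)

text \<open>Inclusion-exclusion on the 4-cycles \<open>abcd\<close> and \<open>abdc\<close> through the matching \<open>ab\<close>, \<open>cd\<close>: both
  are present only if the four vertices span a \<open>K\<^sub>4\<close>.\<close>

lemma two_card_C4_homs_le: "2 * card C4_homs \<le> card (clique_lists 2) ^ 2 + card (clique_lists 4)"
proof -
  define X where "X = C4_homs"
  define Y where "Y = (\<lambda>(a, b, c, d). (a, b, d, c)) ` C4_homs"
  define M where "M = {(a, b). adj a b}"
  define K where "K = {(a, b, c, d). [a, b, c, d] \<in> clique_lists 4}"
  have Y: "(a, b, c, d) \<in> Y \<longleftrightarrow> (a, b, d, c) \<in> C4_homs" for a b c d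
    by (force simp: Y_def)
  have cl4: "[a, b, c, d] \<in> clique_lists 4" if "adj a b" "adj b c" "adj c d" "adj d a" "adj a c" "adj b d" for a b c d
  proof -
    have "distinct [a, b, c, d]" using that by auto
    then show ?thesis using that adj_V by (auto simp: clique_lists_def cliques_def insert_commute)
  qed
  have fin: "finite X" "finite Y" by (simp_all add: X_def Y_def finite_C4_homs)
  have cY: "card Y = card X" unfolding X_def Y_def
    by (intro card_image) (auto simp: inj_on_def)
  have fM: "finite M" by (rule finite_subset[of _ "V \<times> V"]) (use adj_V in \<open>auto simp: M_def\<close>)
  have "M = (\<lambda>xs. (xs ! 0, xs ! 1)) ` clique_lists 2"
  proof (intro equalityI subsetI)
    fix p assume "p \<in> M"
    then obtain a b where ab: "p = (a, b)" "adj a b" by (auto simp: M_def)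
    then have "a \<noteq> b" by auto
    then have "[a, b] \<in> clique_lists 2" using ab adj_V by (auto simp: clique_lists_def cliques_def insert_commute)
    then show "p \<in> (\<lambda>xs. (xs ! 0, xs ! 1)) ` clique_lists 2" using ab by force
  next
    fix p assume "p \<in> (\<lambda>xs. (xs ! 0, xs ! 1)) ` clique_lists 2"
    then obtain xs where xs: "xs \<in> clique_lists 2" "p = (xs ! 0, xs ! 1)" by blast
    then have "length xs = 2" using clique_lists_subset by blast
    then obtain a b where "xs = [a, b]" by (auto simp: length_Suc_conv numeral_2_eq_2)
    then show "p \<in> M" using xs by (auto simp: M_def clique_lists_def cliques_def)
  qed
  then have cM: "card M \<le> card (clique_lists 2)" by (simp add: card_image_le finite_clique_lists)
  have cK: "card K \<le> card (clique_lists 4)"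
    by (rule card_inj_on_le[of "\<lambda>(a, b, c, d). [a, b, c, d]"]) (auto simp: inj_on_def K_def finite_clique_lists)
  have fK: "finite K"
    by (rule finite_subset[of _ "V \<times> V \<times> V \<times> V"]) (auto simp: K_def clique_lists_def cliques_def)
  have "X \<union> Y \<subseteq> (\<lambda>((a, b), (c, d)). (a, b, c, d)) ` (M \<times> M)"
  proof
    fix x assume x: "x \<in> X \<union> Y"
    obtain a b c d where xx: "x = (a, b, c, d)" by (cases x)
    have "adj a b" "adj c d"
      using x xx by (auto simp: X_def Y C4_homs_def insert_commute)
    then show "x \<in> (\<lambda>((a, b), (c, d)). (a, b, c, d)) ` (M \<times> M)" using xx by (force simp: M_def)
  qed
  then have "card (X \<union> Y) \<le> card (M \<times> M)"
    using fM by (intro surj_card_le) auto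
  also have "\<dots> \<le> card (clique_lists 2) ^ 2"
    using cM by (simp add: power2_eq_square card_cartesian_product mult_le_mono)
  finally have U: "card (X \<union> Y) \<le> card (clique_lists 2) ^ 2" .
  have "X \<inter> Y \<subseteq> K"
  proof
    fix x assume x: "x \<in> X \<inter> Y"
    obtain a b c d where xx: "x = (a, b, c, d)" by (cases x)
    show "x \<in> K" using x xx cl4[of a b c d]
      by (auto simp: X_def Y C4_homs_def K_def insert_commute)
  qed
  then have "card (X \<inter> Y) \<le> card (clique_lists 4)" using card_mono[OF fK] cK le_trans by blast
  then show ?thesis using U card_Un_Int[OF fin] cY by (simp add: X_def)
qed

text \<open>The factor \<open>16\<close> consists of the eight labellings of a 4-cycle and the
  factor \<open>2\<close> of the inclusion-exclusion bound.\<close>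

lemma num_copies_C4_le:
  assumes "V \<noteq> {}"
  shows "16 * real (num_copies C4 G) \<le> (cdens 2 ^ 2 + cdens 4) * real (card V) ^ 4"
proof -
  have "card C4_embeddings \<le> card C4_homs"
    using C4_embeddings_subset finite_C4_homs by (rule card_mono[rotated])
  then have "16 * num_copies C4 G \<le> card (clique_lists 2) ^ 2 + card (clique_lists 4)"
    using two_card_C4_homs_le num_copies_C4 by linarith
  then have "16 * real (num_copies C4 G) \<le> real (card (clique_lists 2)) ^ 2 + real (card (clique_lists 4))"
    by (metis (mono_tags, lifting) of_nat_add of_nat_le_iff of_nat_mult of_nat_numeral of_nat_power)
  also have "\<dots> = (cdens 2 ^ 2 + cdens 4) * real (card V) ^ 4"
    using assms by (simp add: card_clique_lists_cdens algebra_simps flip: power_mult)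
  finally show ?thesis .
qed

end

section \<open>Complete multipartite graphs\<close>

definition multipartite :: "'a set \<Rightarrow> ('a \<Rightarrow> nat) \<Rightarrow> 'a graph" where
  "multipartite W p = \<lparr>verts = W, edges = {{u, v} |u v. u \<in> W \<and> v \<in> W \<and> p u \<noteq> p v}\<rparr>"

lemma verts_multipartite [simp]: "verts (multipartite W p) = W"
  by (simp add: multipartite_def)

lemma multipartite_adj: "{u, v} \<in> edges (multipartite W p) \<longleftrightarrow> u \<in> W \<and> v \<in> W \<and> p u \<noteq> p v"
  by (auto simp: multipartite_def doubleton_eq_iff)

lemma simple_multipartite: "finite W \<Longrightarrow> simple_graph (multipartite W p)"
  by (auto simp: simple_graph_def multipartite_def card_2_iff)

lemma multipartite_colouring: "\<forall>v\<in>W. p v < k \<Longrightarrow> proper_colouring (multipartite W p) k p"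
  by (simp add: proper_colouring_def multipartite_adj)

text \<open>A pair whose adjacency changes has an endpoint whose part has changed.\<close>

lemma card_multipartite_diff_le:
  assumes "finite W"
  shows "card (edges (multipartite W p) - edges (multipartite W p')) \<le> card {v\<in>W. p v \<noteq> p' v} * card W"
proof -
  let ?D = "{v\<in>W. p v \<noteq> p' v}"
  have "edges (multipartite W p) - edges (multipartite W p') \<subseteq> (\<lambda>(u, v). {u, v}) ` (?D \<times> W)"
  proof
    fix e assume e: "e \<in> edges (multipartite W p) - edges (multipartite W p')"
    then obtain u v where uv: "e = {u, v}" "u \<in> W" "v \<in> W" "p u \<noteq> p v"
      by (auto simp: multipartite_def)
    have "\<not> p' u \<noteq> p' v" using e uv(1-3) multipartite_adj[of u v W p'] by blast
    with uv have "(u, v) \<in> ?D \<times> W \<or> (v, u) \<in> ?D \<times> W" by auto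
    moreover have "e = (\<lambda>(u, v). {u, v}) (u, v)" "e = (\<lambda>(u, v). {u, v}) (v, u)"
      using uv(1) by auto
    ultimately show "e \<in> (\<lambda>(u, v). {u, v}) ` (?D \<times> W)" by (elim disjE) (rule image_eqI; assumption)+
  qed
  then have "card (edges (multipartite W p) - edges (multipartite W p')) \<le> card (?D \<times> W)"
    using assms by (intro surj_card_le) auto
  then show ?thesis by (simp add: card_cartesian_product)
qed

section \<open>Balancing a partition\<close>

lemma sum_card_parts:
  fixes p :: "'a \<Rightarrow> nat"
  assumes "finite W" "\<forall>v\<in>W. p v < r"
  shows "(\<Sum>i<r. card {v\<in>W. p v = i}) = card W"
proof -
  have "W = (\<Union>i<r. {v\<in>W. p v = i})" using assms by auto
  then have "card W = card (\<Union>i<r. {v\<in>W. p v = i})" by simp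
  also have "\<dots> = (\<Sum>i<r. card {v\<in>W. p v = i})"
    using assms by (intro card_UN_disjoint) auto
  finally show ?thesis by simp
qed

lemma exists_less_of_sum_eq:
  fixes f g :: "nat \<Rightarrow> nat"
  assumes "(\<Sum>i<r. f i) = (\<Sum>i<r. g i)" "i < r" "g i < f i"
  shows "\<exists>j<r. f j < g j"
proof (rule ccontr)
  assume "\<not> ?thesis"
  then have "g x \<le> f x" if "x < r" for x using that not_less by blast
  then have "(\<Sum>i<r. g i) < (\<Sum>i<r. f i)"
    using assms(2,3) by (intro sum_strict_mono_ex1) auto
  with assms(1) show False by simp
qed

text \<open>Moving one vertex from an overfull part to an underfull one lowers the total excess by
  one. Truncated subtraction makes the sum count overfull parts only, so it bounds the number of
  moves and serves as the induction measure.\<close>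

lemma rebalance_partition:
  fixes p :: "'a \<Rightarrow> nat"
  assumes "finite W" "\<forall>v\<in>W. p v < r" "(\<Sum>i<r. m i) = card W"
  shows "\<exists>p'. (\<forall>v\<in>W. p' v < r) \<and> (\<forall>i<r. card {v\<in>W. p' v = i} = m i) \<and>
    card {v\<in>W. p v \<noteq> p' v} \<le> (\<Sum>i<r. card {v\<in>W. p v = i} - m i)"
  using assms(2)
proof (induction "\<Sum>i<r. card {v\<in>W. p v = i} - m i" arbitrary: p)
  case 0
  have sums: "(\<Sum>i<r. card {v\<in>W. p v = i}) = (\<Sum>i<r. m i)"
    using sum_card_parts[OF assms(1) 0(2)] assms(3) by simp
  have le: "card {v\<in>W. p v = i} \<le> m i" if "i < r" for i
    using 0(1) that by simp
  have "card {v\<in>W. p v = i} = m i" if i: "i < r" for i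
  proof (rule ccontr)
    assume "card {v\<in>W. p v = i} \<noteq> m i"
    then have "card {v\<in>W. p v = i} < m i" using le[OF i] by simp
    then have "\<exists>j<r. m j < card {v\<in>W. p v = j}"
      by (rule exists_less_of_sum_eq[OF sums[symmetric] i])
    then show False using le by (auto simp: not_less[symmetric])
  qed
  then show ?case using 0(2) by (intro exI[of _ p]) simp
next
  case (Suc k)
  have sums: "(\<Sum>i<r. card {v\<in>W. p v = i}) = (\<Sum>i<r. m i)"
    using sum_card_parts[OF assms(1) Suc(3)] assms(3) by simp
  have "\<exists>i<r. m i < card {v\<in>W. p v = i}"
  proof (rule ccontr)
    assume "\<not> ?thesis"
    then have "card {v\<in>W. p v = i} - m i = 0" if "i < r" for i using that not_less by auto
    then have "(\<Sum>i<r. card {v\<in>W. p v = i} - m i) = 0" by simp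
    with Suc(2) show False by simp
  qed
  then obtain i where i: "i < r" "m i < card {v\<in>W. p v = i}" by blast
  obtain j where j: "j < r" "card {v\<in>W. p v = j} < m j"
    using exists_less_of_sum_eq[OF sums i] by blast
  have ij: "i \<noteq> j" using i j by auto
  have "{v\<in>W. p v = i} \<noteq> {}" using i(2) by (metis card.empty not_less_zero)
  then obtain w where w: "w \<in> W" "p w = i" by auto
  define q where "q = p(w := j)"
  have qi: "card {v\<in>W. q v = i} = card {v\<in>W. p v = i} - 1"
  proof -
    have "{v\<in>W. q v = i} = {v\<in>W. p v = i} - {w}" using w ij by (auto simp: q_def)
    then show ?thesis using w assms(1) by simp
  qed
  have qj: "card {v\<in>W. q v = j} = Suc (card {v\<in>W. p v = j})"
  proof -
    have "{v\<in>W. q v = j} = insert w {v\<in>W. p v = j}" using w ij by (auto simp: q_def)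
    then show ?thesis using w ij assms(1) by simp
  qed
  have qo: "card {v\<in>W. q v = l} = card {v\<in>W. p v = l}" if "l \<noteq> i" "l \<noteq> j" for l
  proof -
    have "{v\<in>W. q v = l} = {v\<in>W. p v = l}" using w that by (auto simp: q_def)
    then show ?thesis by simp
  qed
  have "(\<Sum>l<r. card {v\<in>W. p v = l} - m l) = (\<Sum>l<r. (card {v\<in>W. q v = l} - m l) + (if l = i then 1 else 0))"
  proof (rule sum.cong[OF refl])
    fix l
    show "card {v\<in>W. p v = l} - m l = card {v\<in>W. q v = l} - m l + (if l = i then 1 else 0)"
      using i(2) j(2) qi qj qo[of l] ij by (cases "l = i"; cases "l = j") auto
  qed
  also have "\<dots> = (\<Sum>l<r. card {v\<in>W. q v = l} - m l) + 1"
    using i(1) by (simp add: sum.distrib)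
  finally have dec: "(\<Sum>l<r. card {v\<in>W. p v = l} - m l) = (\<Sum>l<r. card {v\<in>W. q v = l} - m l) + 1" .
  then have k: "k = (\<Sum>l<r. card {v\<in>W. q v = l} - m l)" using Suc(2) by simp
  have "\<forall>v\<in>W. q v < r" using Suc(3) j by (simp add: q_def)
  from Suc(1)[OF k this] obtain p' where p': "\<forall>v\<in>W. p' v < r" "\<forall>i<r. card {v\<in>W. p' v = i} = m i"
      "card {v\<in>W. q v \<noteq> p' v} \<le> (\<Sum>i<r. card {v\<in>W. q v = i} - m i)"
    by (elim exE conjE)
  \<comment> \<open>Apart from the moved vertex \<open>w\<close>, the maps \<open>p\<close> and
    \<open>q\<close> agree, so \<open>w\<close> accounts for the unit by which the excess
    dropped.\<close>
  have "card {v\<in>W. p v \<noteq> p' v} \<le> card (insert w {v\<in>W. q v \<noteq> p' v})"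
    using assms(1) by (intro card_mono) (auto simp: q_def)
  also have "\<dots> \<le> Suc (card {v\<in>W. q v \<noteq> p' v})" by (rule card_insert_le_m1) simp_all
  also have "\<dots> \<le> (\<Sum>i<r. card {v\<in>W. p v = i} - m i)" using dec p'(3) by simp
  finally show ?case using p'(1,2) by (intro exI[of _ p']) simp
qed

text \<open>A fixed assignment of the two admissible sizes to the parts, since
  \<open>rebalance_partition\<close> needs prescribed sizes with sum \<open>n\<close>.\<close>

definition turan_size :: "nat \<Rightarrow> nat \<Rightarrow> nat \<Rightarrow> nat" where
  "turan_size r n i = n div r + (if i < n mod r then 1 else 0)"

lemma sum_turan_size: "0 < r \<Longrightarrow> (\<Sum>i<r. turan_size r n i) = n"
proof -
  assume r: "0 < r"
  have "{i \<in> {..<r}. i < n mod r} = {..<n mod r}" using r by (auto intro: less_trans)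
  then show ?thesis
    by (simp add: turan_size_def sum.distrib flip: sum.inter_filter)
qed

lemma turan_size_bounds:
  assumes "0 < r"
  shows "real n / r - 1 \<le> real (turan_size r n i)" "real (turan_size r n i) \<le> real n / r + 1"
proof -
  have "real n = r * real (n div r) + real (n mod r)"
    by (metis mult_div_mod_eq of_nat_add of_nat_mult)
  moreover have "real (n mod r) \<le> r" using assms by (simp add: less_imp_le)
  ultimately have "real (n div r) \<le> real n / r" "real n / r \<le> real (n div r) + 1"
    using assms by (auto simp: field_simps)
  then show "real n / r - 1 \<le> real (turan_size r n i)" "real (turan_size r n i) \<le> real n / r + 1"
    by (auto simp: turan_size_def)
qed

lemma turan_size_floor_ceiling:
  assumes "0 < r"
  shows "int (turan_size r n i) \<in> {\<lfloor>real n / real r\<rfloor>, \<lceil>real n / real r\<rceil>}"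
proof (cases "i < n mod r")
  case True
  have e: "real n = r * real (n div r) + real (n mod r)"
    by (metis mult_div_mod_eq of_nat_add of_nat_mult)
  have m: "real (n mod r) \<le> r" "0 < real (n mod r)" using assms True by (simp_all add: less_imp_le)
  have "\<lceil>real n / real r\<rceil> = int (n div r) + 1"
    by (rule ceiling_unique) (use e m assms in \<open>auto simp: field_simps\<close>)
  then show ?thesis using True by (simp add: turan_size_def)
next
  case False
  then show ?thesis by (simp add: turan_size_def floor_divide_of_nat_eq)
qed

lemma is_turan_graph_multipartite:
  assumes "finite W" "0 < r" "\<forall>v\<in>W. p v < r" "\<forall>i<r. card {v\<in>W. p v = i} = turan_size r (card W) i"
  shows "is_turan_graph r (card W) (multipartite W p)"
  unfolding is_turan_graph_def
  using assms turan_size_floor_ceiling[OF assms(2), of "card W"]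
  by (intro conjI exI[of _ p]) (simp_all, simp add: multipartite_def)

section \<open>The number of 4-cycles in the Turan graph\<close>

lemma card_C4_homs_sum:
  assumes "simple_graph G"
  shows "card (finite_graph.C4_homs G) = (\<Sum>a\<in>verts G. \<Sum>c\<in>verts G. card (finite_graph.cnbrs G {a, c}) ^ 2)"
proof -
  interpret finite_graph G using assms by unfold_locales
  \<comment> \<open>A closed walk \<open>abcd\<close> consists of the opposite pair
    \<open>(a, c)\<close> and two independently chosen common neighbours \<open>b\<close> and
    \<open>d\<close>.\<close>
  let ?X = "SIGMA x:V \<times> V. cnbrs {fst x, snd x} \<times> cnbrs {fst x, snd x}"
  have "bij_betw (\<lambda>((a, c), (b, d)). (a, b, c, d)) ?X C4_homs"
    by (rule bij_betwI[where g = "\<lambda>(a, b, c, d). ((a, c), (b, d))"])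
      (auto simp: C4_homs_def cnbrs_def insert_commute dest: adj_V)
  then have "card C4_homs = card ?X" by (rule bij_betw_same_card[symmetric])
  also have "\<dots> = (\<Sum>x\<in>V \<times> V. card (cnbrs {fst x, snd x}) ^ 2)"
    by (subst card_SigmaI) (auto simp: card_cartesian_product power2_eq_square)
  also have "\<dots> = (\<Sum>a\<in>V. \<Sum>c\<in>V. card (cnbrs {a, c}) ^ 2)"
    by (subst sum.cartesian_product) (auto intro: sum.cong)
  finally show ?thesis .
qed

text \<open>With \<open>x = 1/r\<close>, two vertices of one part have about
  \<open>(1 - x) * n\<close> common neighbours and two vertices of different parts about
  \<open>(1 - 2 * x) * n\<close>. The main term is \<open>x * (1 - x)^2 + (1 - x) * (1 - 2 * x)^2 =
  (1 - x) * (1 - 3 * x + 3 * x^2)\<close>, exactly half of the limit of \<open>t_2^2 + t_4\<close>.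
  Of the error \<open>9 * n^3\<close>, seven units pay for rounding and two for degenerate closed
  walks.\<close>

lemma num_copies_C4_turan_ge:
  fixes p :: "'a \<Rightarrow> nat"
  assumes W: "finite W" and r: "3 \<le> r" and p: "\<forall>v\<in>W. p v < r"
    and sz: "\<forall>i<r. card {v\<in>W. p v = i} = turan_size r (card W) i" and n6: "6 \<le> card W"
  defines "n \<equiv> real (card W)"
  shows "8 * real (num_copies C4 (multipartite W p))
    \<ge> (1 - 1 / r) * (1 - 3 / r + 3 / (real r)^2) * n ^ 4 - 9 * n ^ 3"
proof -
  interpret finite_graph "multipartite W p"
    using simple_multipartite[OF W] by unfold_locales
  define m where "m = n / r"
  \<comment> \<open>Lower bounds for the two codegrees, with slack one for each removed part because
    part sizes differ from \<open>m\<close> by at most one. From \<open>3 * m \<le> n\<close> and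
    \<open>n \<ge> 6\<close> it follows that \<open>Y \<ge> 0\<close>, so these bounds may be
    squared.\<close>
  define X where "X = n - m - 1"
  define Y where "Y = n - 2 * m - 2"
  have n: "n \<ge> 6" using n6 by (simp add: n_def)
  have m: "0 \<le> m" "3 * m \<le> n"
  proof -
    have "3 * m \<le> real r * m" using r n by (intro mult_right_mono) (auto simp: m_def)
    then show "0 \<le> m" "3 * m \<le> n" using r n by (auto simp: m_def)
  qed
  have XY: "0 \<le> Y" "Y \<le> X" "X \<le> n" using n m by (auto simp: X_def Y_def)
  have size: "m - 1 \<le> real (card {v\<in>W. p v = i})" "real (card {v\<in>W. p v = i}) \<le> m + 1" if "i < r" for i
    using turan_size_bounds[of r "card W" i] sz that r by (auto simp: m_def n_def)
  have size_le: "real (card {v\<in>W. p v = i}) \<le> n" for i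
    using W by (auto simp: n_def intro!: card_mono)
  have cn: "cnbrs {a, c} = W - ({v\<in>W. p v = p a} \<union> {v\<in>W. p v = p c})" if "a \<in> W" "c \<in> W" for a c
    using that by (auto simp: cnbrs_def multipartite_adj)
  have same: "X \<le> real (card (cnbrs {a, c}))" if "a \<in> W" "c \<in> W" "p c = p a" for a c
  proof -
    have "card (cnbrs {a, c}) = card W - card {v\<in>W. p v = p a}"
      using W that by (simp add: cn card_Diff_subset)
    then have "real (card (cnbrs {a, c})) \<ge> n - card {v\<in>W. p v = p a}" unfolding n_def by linarith
    then show ?thesis using size(2)[of "p a"] p that by (simp add: X_def)
  qed
  have diff: "Y \<le> real (card (cnbrs {a, c}))" if "a \<in> W" "c \<in> W" for a c
  proof -
    let ?U = "{v\<in>W. p v = p a} \<union> {v\<in>W. p v = p c}"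
    have "card (cnbrs {a, c}) = card W - card ?U"
      using W that unfolding cn[OF that] by (intro card_Diff_subset) auto
    moreover have "card ?U \<le> card {v\<in>W. p v = p a} + card {v\<in>W. p v = p c}" by (rule card_Un_le)
    ultimately have "real (card (cnbrs {a, c})) \<ge> n - (card {v\<in>W. p v = p a} + card {v\<in>W. p v = p c})"
      unfolding n_def by linarith
    then show ?thesis using size(2)[of "p a"] size(2)[of "p c"] p that by (simp add: Y_def)
  qed
  have inner: "(m - 1) * X^2 + (n - m) * Y^2 \<le> (\<Sum>c\<in>W. real (card (cnbrs {a, c})) ^ 2)" if a: "a \<in> W" for a
  proof -
    let ?P = "{v\<in>W. p v = p a}"
    define k where "k = real (card ?P)"
    have "m - 1 \<le> k" using size(1)[of "p a"] p a by (simp add: k_def)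
    \<comment> \<open>Since \<open>0 \<le> Y\<close> and \<open>Y \<le> X\<close>, replacing the
      part size \<open>k\<close> by its lower bound \<open>m - 1\<close> can only decrease
      \<open>k * X^2 + (n - k) * Y^2\<close>. Giving up one further \<open>Y^2\<close> leaves the
      weight \<open>n - m\<close> on \<open>Y^2\<close>.\<close>
    then have le: "(m - 1) * (X^2 - Y^2) \<le> k * (X^2 - Y^2)"
      using XY by (intro mult_right_mono) (auto intro: power_mono)
    have "(m - 1) * X^2 + (n - m) * Y^2 = (m - 1) * (X^2 - Y^2) + n * Y^2 - Y^2"
      by (simp add: algebra_simps)
    also have "\<dots> \<le> (m - 1) * (X^2 - Y^2) + n * Y^2" by simp
    also have "\<dots> \<le> k * (X^2 - Y^2) + n * Y^2" using le by (rule add_right_mono)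
    also have "\<dots> = k * X^2 + (n - k) * Y^2" by (simp add: algebra_simps)
    also have "\<dots> = (\<Sum>c\<in>?P. X^2) + (\<Sum>c\<in>W - ?P. Y^2)"
    proof -
      have "card (W - ?P) = card W - card ?P" using W by (intro card_Diff_subset) auto
      moreover have "card ?P \<le> card W" using W by (intro card_mono) auto
      ultimately show ?thesis by (simp add: k_def n_def of_nat_diff)
    qed
    also have "\<dots> \<le> (\<Sum>c\<in>?P. real (card (cnbrs {a, c})) ^ 2) + (\<Sum>c\<in>W - ?P. real (card (cnbrs {a, c})) ^ 2)"
      using same[OF a] diff[OF a] XY by (intro add_mono sum_mono power_mono) auto
    also have "\<dots> = (\<Sum>c\<in>W. real (card (cnbrs {a, c})) ^ 2)"
      using W by (subst sum.subset_diff[of ?P W]) auto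
    finally show ?thesis .
  qed
  have "n * ((m - 1) * X^2 + (n - m) * Y^2) = (\<Sum>a\<in>W. (m - 1) * X^2 + (n - m) * Y^2)"
    by (simp add: n_def)
  also have "\<dots> \<le> (\<Sum>a\<in>W. \<Sum>c\<in>W. real (card (cnbrs {a, c})) ^ 2)"
    by (intro sum_mono inner)
  also have "\<dots> = real (card C4_homs)"
    using card_C4_homs_sum[OF simple] by simp
  also have "\<dots> \<le> real (card C4_embeddings) + 2 * n ^ 3"
    using card_C4_homs_le unfolding n_def verts_multipartite by (metis (mono_tags, lifting) of_nat_add of_nat_le_iff of_nat_mult of_nat_numeral of_nat_power)
  also have "real (card C4_embeddings) = 8 * real (num_copies C4 (multipartite W p))"
    using num_copies_C4 by (metis of_nat_mult of_nat_numeral)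
  finally have *: "n * ((m - 1) * X^2 + (n - m) * Y^2) \<le> 8 * real (num_copies C4 (multipartite W p)) + 2 * n ^ 3" .
  have "X^2 \<le> n^2" using XY by (intro power_mono) auto
  moreover have "X^2 \<ge> (n - m)^2 - 2 * n"
    using n m by (simp add: X_def power2_eq_square algebra_simps)
  then have "m * X^2 \<ge> m * ((n - m)^2 - 2 * n)" using m by (intro mult_left_mono)
  moreover have "Y^2 \<ge> (n - 2 * m)^2 - 4 * n"
    using n m by (simp add: Y_def power2_eq_square algebra_simps)
  then have "(n - m) * Y^2 \<ge> (n - m) * ((n - 2 * m)^2 - 4 * n)" using m n by (intro mult_left_mono) auto
  moreover have "m * n \<le> n * n" using m n by (intro mult_right_mono) auto
  moreover have "0 \<le> m * n" using m n by simp
  ultimately have "(m - 1) * X^2 + (n - m) * Y^2 \<ge> m * (n - m)^2 + (n - m) * (n - 2 * m)^2 - 7 * n^2"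
    by (simp add: algebra_simps power2_eq_square)
  then have "n * ((m - 1) * X^2 + (n - m) * Y^2) \<ge> n * (m * (n - m)^2 + (n - m) * (n - 2 * m)^2 - 7 * n^2)"
    using n by (intro mult_left_mono) auto
  moreover have "n * (m * (n - m)^2 + (n - m) * (n - 2 * m)^2 - 7 * n^2)
      = (1 - 1 / r) * (1 - 3 / r + 3 / (real r)^2) * n ^ 4 - 7 * n ^ 3"
  proof -
    define x where "x = 1 / real r"
    have m': "m = x * n" by (simp add: m_def x_def)
    have x': "3 / real r = 3 * x" "1 / real r = x" "3 / (real r)^2 = 3 * x^2"
      by (simp_all add: x_def power_divide)
    show ?thesis unfolding m' x' by (simp add: algebra_simps power2_eq_square power3_eq_cube power4_eq_xxxx)
  qed
  ultimately show ?thesis using * by linarith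
qed

section \<open>The lower bound for the extremal number\<close>

lemma ex_turan_ge:
  fixes G :: "nat graph"
  assumes "simple_graph G" "verts G = {..<n}" "free_of F G"
  shows "num_copies H G \<le> ex_turan n H F"
proof -
  \<comment> \<open>\<open>Max\<close> dominates its members only for a finite set; a graph on
    \<open>{..<n}\<close> is determined by its edge set.\<close>
  have "finite {G :: nat graph. simple_graph G \<and> verts G = {..<n}}" (is "finite ?A")
  proof (rule finite_subset)
    show "?A \<subseteq> (\<lambda>E. \<lparr>verts = {..<n}, edges = E\<rparr>) ` Pow (Pow {..<n})"
    proof
      fix G assume G: "G \<in> ?A"
      then have "G = \<lparr>verts = {..<n}, edges = edges G\<rparr>" "edges G \<in> Pow (Pow {..<n})"
        by (auto simp: simple_graph_def)
      then show "G \<in> (\<lambda>E. \<lparr>verts = {..<n}, edges = E\<rparr>) ` Pow (Pow {..<n})" by (rule image_eqI)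
    qed
  qed simp
  then have "finite (num_copies H ` ?A)" by simp
  then have "finite {num_copies H G |G :: nat graph. simple_graph G \<and> verts G = {..<n} \<and> free_of F G}"
    by (rule rev_finite_subset) auto
  then show ?thesis unfolding ex_turan_def using assms by (intro Max_ge) auto
qed

text \<open>Obtained by rebalancing the trivial partition that puts every vertex into part
  \<open>0\<close>.\<close>

lemma exists_turan_partition:
  assumes "finite W" "0 < r"
  shows "\<exists>p. (\<forall>v\<in>W. p v < r) \<and> (\<forall>i<r. card {v\<in>W. p v = i} = turan_size r (card W) i)"
  using rebalance_partition[OF assms(1) _ sum_turan_size[OF assms(2)], of "\<lambda>_. 0"] assms(2) by auto

lemma ex_turan_C4_ge:
  assumes "3 \<le> r" "r < chromatic_number F" "6 \<le> n"
  shows "8 * real (ex_turan n C4 F) \<ge> (1 - 1 / r) * (1 - 3 / r + 3 / (real r)^2) * real n ^ 4 - 9 * real n ^ 3"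
proof -
  have "0 < r" using assms by simp
  then obtain p where p: "\<forall>v\<in>{..<n}. p v < r" "\<forall>i<r. card {v\<in>{..<n}. p v = i} = turan_size r (card {..<n}) i"
    using exists_turan_partition[of "{..<n}" r] by auto
  let ?T = "multipartite {..<n} p"
  have "free_of F ?T"
    by (rule free_of_colourable[OF simple_multipartite multipartite_colouring[OF p(1)] assms(2)]) simp
  then have "num_copies C4 ?T \<le> ex_turan n C4 F"
    by (intro ex_turan_ge simple_multipartite) auto
  moreover have "8 * real (num_copies C4 ?T)
    \<ge> (1 - 1 / r) * (1 - 3 / r + 3 / (real r)^2) * real n ^ 4 - 9 * real n ^ 3"
    using num_copies_C4_turan_ge[OF _ assms(1) p] assms(3) by simp
  ultimately show ?thesis by linarith
qed

section \<open>Stability\<close>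

context finite_graph
begin

section \<open>Degree concentration and cliques of high degree vertices\<close>

definition deg :: "'a \<Rightarrow> nat" where
  "deg v = card (cnbrs {v})"

lemma cliques_1: "cliques V 1 = (\<lambda>v. {v}) ` V"
  by (auto simp: cliques_def card_1_singleton_iff)

lemma sum_deg: "V \<noteq> {} \<Longrightarrow> (\<Sum>v\<in>V. real (deg v)) = cdens 2 * real (card V) ^ 2"
proof -
  assume V: "V \<noteq> {}"
  have cV: "cnbrs R \<inter> V = cnbrs R" for R using cnbrs_subset by auto
  have "(\<Sum>v\<in>V. deg v) = (\<Sum>R\<in>cliques V 1. card (cnbrs R \<inter> V))"
    unfolding cliques_1 cV by (subst sum.reindex) (auto simp: deg_def)
  also have "\<dots> = 2 * card (cliques V 2)"
    using sum_card_cnbrs[of V 1] by (simp add: numeral_2_eq_2)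
  finally have "(\<Sum>v\<in>V. real (deg v)) = 2 * real (card (cliques V 2))"
    by (metis of_nat_mult of_nat_numeral of_nat_sum)
  then show ?thesis using V by (simp add: card_cliques_cdens)
qed

text \<open>The case \<open>s = 1\<close> of \<open>sum_cnbrs_squared_le\<close>, before
  Cauchy-Schwarz: triangles control the second moment of the degrees.\<close>

lemma sum_deg_squared_le:
  "V \<noteq> {} \<Longrightarrow> (\<Sum>v\<in>V. real (deg v) ^ 2) \<le> (cdens 2 + cdens 3) / 2 * real (card V) ^ 3"
proof -
  assume V: "V \<noteq> {}"
  have "(\<Sum>v\<in>V. deg v ^ 2) = (\<Sum>R\<in>cliques V 1. card (cnbrs R) ^ 2)"
    unfolding cliques_1 by (subst sum.reindex) (auto simp: deg_def)
  also have "\<dots> \<le> card V * card (cliques V 2) + 3 * card (cliques V 3)"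
    using sum_cnbrs_squared_le[of 1] by (simp add: numeral_2_eq_2 numeral_3_eq_3)
  finally have "(\<Sum>v\<in>V. real (deg v) ^ 2) \<le> real (card V) * card (cliques V 2) + 3 * card (cliques V 3)"
    by (metis (mono_tags, lifting) of_nat_add of_nat_le_iff of_nat_mult of_nat_numeral of_nat_power of_nat_sum sum.cong)
  also have "\<dots> = (cdens 2 + cdens 3) / 2 * real (card V) ^ 3"
  proof -
    have "(fact 3 :: real) = 6" by (simp add: fact_numeral)
    then have "real (card (cliques V 2)) = cdens 2 * real (card V) ^ 2 / 2"
        "real (card (cliques V 3)) = cdens 3 * real (card V) ^ 3 / 6"
      using card_cliques_cdens[OF V] by simp_all
    then show ?thesis by (simp only:) (simp add: power2_eq_square power3_eq_cube algebra_simps)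
  qed
  finally show ?thesis .
qed

text \<open>Chebyshev's inequality around \<open>q * n\<close>, applied with
  \<open>q = 1 - 1/r\<close>, for which \<open>2 * q - 1 = 1 - 2/r\<close> is the chain coefficient
  at \<open>s = 2\<close>. The mean of \<open>(q * n - deg v)^2\<close> is at most
  \<open>(q * (q - t_2) + c/2) * n^2\<close>, hence at most \<open>\<beta>^3 * n^2\<close>; dividing
  by the squared deviation \<open>(\<beta> * n)^2\<close> leaves a fraction \<open>\<beta>\<close>
  of the vertices.\<close>

lemma card_low_degree_le:
  assumes V: "V \<noteq> {}" and q: "0 \<le> q" "q \<le> 1" and \<beta>: "0 < \<beta>" and c: "0 \<le> c'" "c + c' \<le> \<beta> ^ 3" "0 \<le> c"
    and t2: "q - c' \<le> cdens 2" and t3: "cdens 3 \<le> (2 * q - 1) * cdens 2 + c"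
  shows "real (card {v\<in>V. real (deg v) < (q - \<beta>) * card V}) \<le> \<beta> * card V"
proof -
  define n where "n = real (card V)"
  have n: "n > 0" using V by (simp add: n_def card_gt_0_iff)
  let ?L = "{v\<in>V. real (deg v) < (q - \<beta>) * n}"
  have "real (card ?L) * (\<beta> * n)^2 = (\<Sum>v\<in>?L. (\<beta> * n)^2)" by simp
  also have "\<dots> \<le> (\<Sum>v\<in>?L. (q * n - real (deg v))^2)"
  proof (intro sum_mono power_mono)
    fix v assume "v \<in> ?L"
    then show "\<beta> * n \<le> q * n - real (deg v)" by (simp add: algebra_simps)
    show "0 \<le> \<beta> * n" using \<beta> n by simp
  qed
  also have "\<dots> \<le> (\<Sum>v\<in>V. (q * n - real (deg v))^2)"
    by (intro sum_mono2) auto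
  also have "\<dots> = (\<Sum>v\<in>V. q^2 * n^2 - 2 * q * n * real (deg v) + real (deg v)^2)"
    by (intro sum.cong refl) (simp add: power2_eq_square algebra_simps)
  also have "\<dots> = n * (q^2 * n^2) - 2 * q * n * (\<Sum>v\<in>V. real (deg v)) + (\<Sum>v\<in>V. real (deg v)^2)"
    by (simp add: sum.distrib sum_subtractf sum_distrib_left n_def)
  also have "\<dots> \<le> n * (q^2 * n^2) - 2 * q * n * (cdens 2 * n^2) + (cdens 2 + cdens 3) / 2 * n^3"
    using sum_deg[OF V] sum_deg_squared_le[OF V] by (simp add: n_def)
  also have "\<dots> = (q^2 - 2 * q * cdens 2 + (cdens 2 + cdens 3) / 2) * n^3"
    by (simp add: algebra_simps power2_eq_square power3_eq_cube)
  also have "\<dots> \<le> \<beta> ^ 3 * n^3"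
  proof (rule mult_right_mono)
    have "q^2 - 2 * q * cdens 2 + (cdens 2 + cdens 3) / 2 \<le> q * (q - cdens 2) + c / 2"
      using t3 by (simp add: algebra_simps power2_eq_square)
    also have "q * (q - cdens 2) \<le> q * c'" using t2 q by (intro mult_left_mono) auto
    also have "q * c' \<le> 1 * c'" using q c by (intro mult_right_mono) auto
    finally show "q^2 - 2 * q * cdens 2 + (cdens 2 + cdens 3) / 2 \<le> \<beta> ^ 3" using c by simp
  qed (use n in simp)
  finally have "real (card ?L) * (\<beta> * n)^2 \<le> (\<beta> * n) * (\<beta> * n)^2"
    by (simp add: power2_eq_square power3_eq_cube mult_ac)
  then have "real (card ?L) \<le> \<beta> * n"
    by (rule mult_right_le_imp_le) (use \<beta> n in simp)
  then show ?thesis by (simp add: n_def)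
qed

lemma card_nonadj: "x \<in> V \<Longrightarrow> real (card {v\<in>V. \<not> adj x v}) = real (card V) - real (deg x)"
proof -
  have "{v\<in>V. \<not> adj x v} = V - cnbrs {x}" by (auto simp: cnbrs_def)
  then have "card {v\<in>V. \<not> adj x v} = card V - deg x"
    using cnbrs_subset by (simp add: deg_def card_Diff_subset)
  moreover have "deg x \<le> card V" unfolding deg_def using cnbrs_subset by (intro card_mono) auto
  ultimately show ?thesis by simp
qed

text \<open>At most \<open>r - 1\<close> vertices exclude at most \<open>(1/r + \<beta>) * n\<close>
  vertices each, and \<open>V - W\<close> excludes \<open>\<beta> * n\<close> more. What is left is
  at least \<open>n/r - r * \<beta> * n\<close>, and the bound on \<open>\<beta>\<close> makes the
  subtracted term at most half of \<open>n/r\<close>.\<close>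

lemma card_cnbrs_high_degree_ge:
  fixes \<beta> :: real and r :: nat
  assumes W: "W \<subseteq> V" and deg: "\<And>v. v \<in> W \<Longrightarrow> (1 - 1 / r - \<beta>) * card V \<le> deg v"
    and cW: "real (card (V - W)) \<le> \<beta> * card V" and \<beta>: "0 < \<beta>" "\<beta> \<le> 1 / (2 * real r ^ 2)"
    and R: "R \<in> cliques W s" and s: "s < r"
  shows "real (card V) / (2 * r) \<le> real (card (cnbrs R \<inter> W))"
proof -
  define n where "n = real (card V)"
  have finR: "finite R" using R W finV finite_clique finite_subset by metis
  have cR: "card R = s" and RW: "R \<subseteq> W" using R by (auto simp: cliques_def)
  have "V \<subseteq> (cnbrs R \<inter> W) \<union> ((\<Union>x\<in>R. {v\<in>V. \<not> adj x v}) \<union> (V - W))"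
    by (auto simp: cnbrs_def)
  then have "card V \<le> card ((cnbrs R \<inter> W) \<union> ((\<Union>x\<in>R. {v\<in>V. \<not> adj x v}) \<union> (V - W)))"
    using finR by (intro card_mono) auto
  also have "\<dots> \<le> card (cnbrs R \<inter> W) + (card (\<Union>x\<in>R. {v\<in>V. \<not> adj x v}) + card (V - W))"
    by (meson add_left_mono card_Un_le le_trans)
  also have "card (\<Union>x\<in>R. {v\<in>V. \<not> adj x v}) \<le> (\<Sum>x\<in>R. card {v\<in>V. \<not> adj x v})"
    by (rule card_UN_le[OF finR])
  finally have "n \<le> real (card (cnbrs R \<inter> W)) + (\<Sum>x\<in>R. real (card {v\<in>V. \<not> adj x v})) + real (card (V - W))"
    unfolding n_def by (simp flip: of_nat_add of_nat_sum)
  also have "(\<Sum>x\<in>R. real (card {v\<in>V. \<not> adj x v})) \<le> (\<Sum>x\<in>R. (1 / r + \<beta>) * n)"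
  proof (rule sum_mono)
    fix x assume "x \<in> R"
    then have "x \<in> W" "x \<in> V" using RW W by auto
    then show "real (card {v\<in>V. \<not> adj x v}) \<le> (1 / r + \<beta>) * n"
      using deg[of x] card_nonadj[of x] by (simp add: n_def algebra_simps)
  qed
  also have "\<dots> = real s * ((1 / r + \<beta>) * n)" by (simp add: cR)
  also have "\<dots> \<le> (real r - 1) * ((1 / r + \<beta>) * n)"
    using s \<beta> by (intro mult_right_mono) (auto simp: n_def)
  finally have A: "n \<le> real (card (cnbrs R \<inter> W)) + (real r - 1) * ((1 / r + \<beta>) * n) + \<beta> * n"
    using cW by (simp add: n_def)
  have B: "(real r - 1) * ((1 / r + \<beta>) * n) + \<beta> * n = n - n / r + r * \<beta> * n"
    using s by (simp add: field_simps)
  have "r * \<beta> * n \<le> n / (2 * r)"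
  proof -
    have "r * \<beta> \<le> r * (1 / (2 * real r ^ 2))" using \<beta> by (intro mult_left_mono) auto
    also have "\<dots> = 1 / (2 * r)" using s by (simp add: power2_eq_square)
    finally have "r * \<beta> * n \<le> 1 / (2 * r) * n" by (intro mult_right_mono) (auto simp: n_def)
    then show ?thesis by simp
  qed
  then have "n / r \<le> real (card (cnbrs R \<inter> W)) + n / (2 * r)" using A B by linarith
  moreover have "n / r = n / (2 * r) + n / (2 * r)" by (simp add: field_simps)
  ultimately show ?thesis unfolding n_def by linarith
qed

text \<open>Greedy extension: a clique in \<open>W\<close> with fewer than \<open>r\<close> vertices
  extends inside \<open>W\<close> in at least \<open>n / (2 * r)\<close> ways, and the factorial
  accounts for the order of the choices.\<close>

lemma card_cliques_high_degree_ge: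
  fixes \<beta> :: real and r :: nat
  assumes W: "W \<subseteq> V" and deg: "\<And>v. v \<in> W \<Longrightarrow> (1 - 1 / r - \<beta>) * card V \<le> deg v"
    and cW: "real (card (V - W)) \<le> \<beta> * card V" and \<beta>: "0 < \<beta>" "\<beta> \<le> 1 / (2 * real r ^ 2)"
    and s: "s \<le> r" "0 < r"
  shows "(real (card V) / (2 * r)) ^ s / fact s \<le> real (card (cliques W s))"
  using s(1)
proof (induction s)
  case 0
  have "finite W" using W finV finite_subset by blast
  then show ?case by (simp add: cliques_0)
next
  case (Suc s)
  let ?a = "real (card V) / (2 * r)"
  have "?a ^ Suc s / fact s = ?a * (?a ^ s / fact s)" by simp
  also have "\<dots> \<le> ?a * real (card (cliques W s))"
    using Suc s by (intro mult_left_mono) auto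
  also have "\<dots> = (\<Sum>R\<in>cliques W s. ?a)" by simp
  also have "\<dots> \<le> (\<Sum>R\<in>cliques W s. real (card (cnbrs R \<inter> W)))"
    using card_cnbrs_high_degree_ge[OF W deg cW \<beta>] Suc.prems by (intro sum_mono) auto
  also have "\<dots> = real (Suc s) * real (card (cliques W (Suc s)))"
    using sum_card_cnbrs[OF W, of s] by (metis of_nat_mult of_nat_sum)
  finally have "?a ^ Suc s / fact s / real (Suc s) \<le> real (card (cliques W (Suc s)))"
    by (simp add: divide_le_eq mult.commute del: of_nat_Suc power_Suc)
  then show ?case by (simp add: mult.commute del: of_nat_Suc power_Suc)
qed

section \<open>Reading a partition off a good clique\<close>

definition edges_in :: "'a set \<Rightarrow> ('a \<times> 'a) set" where
  "edges_in R = {(u, v). u \<in> cnbrs R \<and> v \<in> cnbrs R \<and> adj u v}"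

lemma finite_edges_in: "finite (edges_in R)"
  by (rule finite_subset[of _ "cnbrs R \<times> cnbrs R"]) (auto simp: edges_in_def)

lemma card_edges_in: "card (edges_in R) = (\<Sum>u\<in>cnbrs R. card (cnbrs (insert u R)))"
proof -
  have "edges_in R = (SIGMA u:cnbrs R. cnbrs (insert u R))"
    by (auto simp: edges_in_def cnbrs_def)
  then show ?thesis by simp
qed

text \<open>An \<open>s\<close>-clique \<open>R\<close> occurs as \<open>Q - {x}\<close> for
  \<open>card (cnbrs R)\<close>, hence at most \<open>card V\<close>, pairs \<open>(Q, x)\<close>.
  The ordered pairs in \<open>edges_in R\<close> extend \<open>R\<close> to
  \<open>(s+2)\<close>-cliques, and each of those arises in \<open>(s+1) * (s+2)\<close>
  ways.\<close>

lemma sum_edges_in_le: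
  "(\<Sum>Q\<in>cliques V (Suc s). \<Sum>x\<in>Q. card (edges_in (Q - {x}))) \<le> card V * (Suc s * (s + 2)) * card (cliques V (s + 2))"
proof -
  have cV: "cnbrs R \<inter> V = cnbrs R" for R using cnbrs_subset by auto
  have "(\<Sum>Q\<in>cliques V (Suc s). \<Sum>x\<in>Q. card (edges_in (Q - {x})))
      = (\<Sum>R\<in>cliques V s. \<Sum>x\<in>cnbrs R \<inter> V. card (edges_in R))"
    by (rule sum_cliques_Suc) simp
  also have "\<dots> = (\<Sum>R\<in>cliques V s. card (cnbrs R) * card (edges_in R))"
    by (simp add: cV)
  also have "\<dots> \<le> (\<Sum>R\<in>cliques V s. card V * card (edges_in R))"
    using cnbrs_subset by (intro sum_mono mult_right_mono card_mono) auto
  also have "\<dots> = card V * (\<Sum>R\<in>cliques V s. \<Sum>u\<in>cnbrs R \<inter> V. card (cnbrs (insert u R)))"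
    by (simp add: sum_distrib_left card_edges_in cV)
  also have "(\<Sum>R\<in>cliques V s. \<Sum>u\<in>cnbrs R \<inter> V. card (cnbrs (insert u R)))
      = (\<Sum>Q\<in>cliques V (Suc s). \<Sum>x\<in>Q. card (cnbrs (insert x (Q - {x}))))"
    by (rule sum_cliques_Suc[symmetric]) simp
  also have "\<dots> = (\<Sum>Q\<in>cliques V (Suc s). Suc s * card (cnbrs Q \<inter> V))"
  proof (rule sum.cong[OF refl])
    fix Q assume "Q \<in> cliques V (Suc s)"
    then have "card Q = Suc s" by (simp add: cliques_def)
    moreover have "(\<Sum>x\<in>Q. card (cnbrs (insert x (Q - {x})))) = (\<Sum>x\<in>Q. card (cnbrs Q))"
      by (rule sum.cong) (auto simp: insert_absorb)
    ultimately show "(\<Sum>x\<in>Q. card (cnbrs (insert x (Q - {x})))) = Suc s * card (cnbrs Q \<inter> V)"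
      by (simp add: cV)
  qed
  also have "\<dots> = Suc s * (\<Sum>Q\<in>cliques V (Suc s). card (cnbrs Q \<inter> V))"
    by (simp only: sum_distrib_left)
  also have "\<dots> = Suc s * (s + 2) * card (cliques V (s + 2))"
    by (subst sum_card_cnbrs) (simp_all add: algebra_simps)
  finally show ?thesis by (simp only: mult.assoc)
qed

text \<open>A clique \<open>Q\<close> as below almost determines the parts: nearly every vertex misses exactly one
  vertex of \<open>Q\<close>, and two adjacent vertices that miss the same \<open>x \<in> Q\<close> are rare since together
  with \<open>Q - {x}\<close> they form a \<open>K\<^sub>r\<^sub>+\<^sub>1\<close>.\<close>

lemma exists_good_clique:
  fixes \<beta> :: real and r :: nat
  assumes W: "W \<subseteq> V" and deg: "\<And>v. v \<in> W \<Longrightarrow> (1 - 1 / r - \<beta>) * card V \<le> deg v"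
    and cW: "real (card (V - W)) \<le> \<beta> * card V" and \<beta>: "0 < \<beta>" "\<beta> \<le> 1 / (2 * real r ^ 2)"
    and r: "0 < r" and V: "V \<noteq> {}"
    and few: "cdens (Suc r) * ((real r + 1)^2 * (2 * r) ^ r * fact r) \<le> \<beta>"
  shows "\<exists>Q\<in>cliques W r. real (card (cnbrs Q)) \<le> \<beta> * card V
           \<and> real (\<Sum>x\<in>Q. card (edges_in (Q - {x}))) \<le> \<beta> * real (card V) ^ 2"
proof -
  define n where "n = real (card V)"
  have n: "n > 0" using V by (simp add: n_def card_gt_0_iff)
  have cV: "cnbrs R \<inter> V = cnbrs R" for R using cnbrs_subset by auto
  have finW: "finite W" using W finV finite_subset by blast
  obtain s where s: "r = Suc s" using r by (cases r) auto
  \<comment> \<open>Both requirements are averaged at once: the weight \<open>n\<close> puts the two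
    terms on the same scale, and being nonnegative they are both controlled by
    \<open>g Q \<le> \<beta> * n^2\<close>.\<close>
  define g where "g Q = real (\<Sum>x\<in>Q. card (edges_in (Q - {x}))) + n * real (card (cnbrs Q))" for Q
  define w where "w = (n / (2 * r)) ^ r / fact r"
  have w: "0 < w" using n r by (simp add: w_def)
  have cw: "w \<le> real (card (cliques W r))"
    using card_cliques_high_degree_ge[OF W deg cW \<beta> order_refl r] by (simp add: w_def n_def)
  have "(\<Sum>Q\<in>cliques W r. g Q) \<le> (\<Sum>Q\<in>cliques V r. g Q)"
    using cliques_mono[OF W] n by (intro sum_mono2) (auto simp: g_def intro!: add_nonneg_nonneg sum_nonneg)
  also have "\<dots> = real (\<Sum>Q\<in>cliques V r. \<Sum>x\<in>Q. card (edges_in (Q - {x}))) + n * real (\<Sum>Q\<in>cliques V r. card (cnbrs Q \<inter> V))"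
    by (simp add: g_def sum.distrib sum_distrib_left cV)
  also have "\<dots> \<le> n * (real r * (real r + 1)) * real (card (cliques V (Suc r))) + n * ((real r + 1) * real (card (cliques V (Suc r))))"
  proof (rule add_mono)
    have "real (\<Sum>Q\<in>cliques V r. \<Sum>x\<in>Q. card (edges_in (Q - {x}))) \<le> real (card V * (r * Suc r) * card (cliques V (Suc r)))"
      using sum_edges_in_le[of s] unfolding s by (simp only: of_nat_le_iff add_2_eq_Suc')
    then show "real (\<Sum>Q\<in>cliques V r. \<Sum>x\<in>Q. card (edges_in (Q - {x}))) \<le> n * (real r * (real r + 1)) * real (card (cliques V (Suc r)))"
      by (simp add: n_def algebra_simps)
    show "n * real (\<Sum>Q\<in>cliques V r. card (cnbrs Q \<inter> V)) \<le> n * ((real r + 1) * real (card (cliques V (Suc r))))"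
      using sum_card_cnbrs[of V r] by (simp add: algebra_simps)
  qed
  also have "\<dots> = n * (real r + 1)^2 * real (card (cliques V (Suc r)))"
    by (simp add: power2_eq_square algebra_simps)
  also have "\<dots> \<le> n * (real r + 1)^2 * (cdens (Suc r) * n ^ Suc r)"
  proof (rule mult_left_mono)
    have "real (card (cliques V (Suc r))) = cdens (Suc r) * n ^ Suc r / fact (Suc r)"
      using card_cliques_cdens[OF V] by (simp only: n_def)
    also have "\<dots> \<le> cdens (Suc r) * n ^ Suc r / 1"
      using n fact_ge_1[of "Suc r", where ?'a = real] by (intro divide_left_mono) (auto simp del: fact_Suc)
    finally show "real (card (cliques V (Suc r))) \<le> cdens (Suc r) * n ^ Suc r" by simp
  qed (use n in simp)
  \<comment> \<open>The constant in the assumption \<open>few\<close> is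
    \<open>(r+1)^2 * n^r / w\<close>, where \<open>(r+1)^2 = r * (r+1) + (r+1)\<close> adds up the
    two double counts and \<open>w\<close> is the guaranteed number of \<open>r\<close>-cliques in
    \<open>W\<close>.\<close>
  also have "\<dots> = (cdens (Suc r) * ((real r + 1)^2 * (2 * r) ^ r * fact r)) * n^2 * w"
    using r by (simp add: w_def power_divide power2_eq_square)
  also have "\<dots> \<le> \<beta> * n^2 * w" using few w n by (intro mult_right_mono) auto
  finally have sum_le: "(\<Sum>Q\<in>cliques W r. g Q) \<le> \<beta> * n^2 * w" .
  have "\<exists>Q\<in>cliques W r. g Q \<le> \<beta> * n^2"
  proof (rule ccontr)
    assume no: "\<not> ?thesis"
    have ne: "cliques W r \<noteq> {}" using cw w by auto
    have "\<beta> * n^2 * w \<le> \<beta> * n^2 * real (card (cliques W r))"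
      using cw \<beta> n by (intro mult_left_mono) auto
    also have "\<dots> = (\<Sum>Q\<in>cliques W r. \<beta> * n^2)" by simp
    also have "\<dots> < (\<Sum>Q\<in>cliques W r. g Q)"
      using no ne finW by (intro sum_strict_mono) (auto simp: not_le)
    finally show False using sum_le by simp
  qed
  then obtain Q where Q: "Q \<in> cliques W r" "g Q \<le> \<beta> * n^2" by blast
  have "n * real (card (cnbrs Q)) \<le> n * (\<beta> * n)"
    using Q(2) sum_nonneg[of Q "\<lambda>x. real (card (edges_in (Q - {x})))"] by (simp add: g_def power2_eq_square mult_ac)
  then have "real (card (cnbrs Q)) \<le> \<beta> * n" using n by simp
  moreover have "real (\<Sum>x\<in>Q. card (edges_in (Q - {x}))) \<le> \<beta> * n^2"
  proof -
    have "0 \<le> n * real (card (cnbrs Q))" using n by simp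
    then show ?thesis using Q(2) unfolding g_def by linarith
  qed
  ultimately show ?thesis using Q(1) unfolding n_def by (intro bexI[of _ Q] conjI)
qed

text \<open>The vertices of \<open>Q\<close> have together at most
  \<open>(1 + r * \<beta>) * n\<close> non-neighbours and few vertices miss none of
  \<open>Q\<close>, so at most \<open>(r + 2) * \<beta> * n\<close> vertices do not miss exactly
  one. Pairs meeting this exceptional set \<open>Z\<close> cost
  \<open>2 * (r + 2) * \<beta> * n^2\<close>; adjacent pairs in a common part outside
  \<open>Z\<close> lie in some \<open>edges_in (Q - {x})\<close> and cost
  \<open>\<beta> * n^2\<close>.\<close>

lemma exists_partition_of_good_clique:
  fixes \<beta> :: real and r :: nat
  assumes Q: "Q \<subseteq> V" "card Q = r" "0 < r" and deg: "\<And>v. v \<in> Q \<Longrightarrow> (1 - 1 / r - \<beta>) * card V \<le> deg v"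
    and few: "real (card (cnbrs Q)) \<le> \<beta> * card V"
      "real (\<Sum>x\<in>Q. card (edges_in (Q - {x}))) \<le> \<beta> * real (card V) ^ 2"
  shows "\<exists>p :: 'a \<Rightarrow> nat. (\<forall>v\<in>V. p v < r)
           \<and> real (card {(u, v). adj u v \<and> p u = p v}) \<le> (2 * real r + 5) * \<beta> * real (card V) ^ 2"
proof -
  define n where "n = real (card V)"
  have finQ: "finite Q" using Q finV finite_subset by blast
  define miss where "miss v = {x\<in>Q. \<not> adj x v}" for v
  have fm: "finite (miss v)" for v using finQ by (simp add: miss_def)
  define Z0 where "Z0 = {v\<in>V. card (miss v) = 0}"
  define Z2 where "Z2 = {v\<in>V. 2 \<le> card (miss v)}"
  have Z0: "real (card Z0) \<le> \<beta> * n"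
  proof -
    have "Z0 = cnbrs Q" using fm by (auto simp: Z0_def cnbrs_def miss_def)
    then show ?thesis using few by (simp add: n_def)
  qed
  \<comment> \<open>Pointwise, \<open>card (miss v)\<close> is at least \<open>1\<close>, plus one
    on \<open>Z2\<close> and minus one on \<open>Z0\<close>; summation bounds \<open>Z2\<close> in
    terms of \<open>Z0\<close>.\<close>
  have "n + real (card Z2) - real (card Z0) = (\<Sum>v\<in>V. 1 + (if v \<in> Z2 then 1 else 0) - (if v \<in> Z0 then 1 else 0))"
  proof -
    have "V \<inter> Z2 = Z2" "V \<inter> Z0 = Z0" by (auto simp: Z2_def Z0_def)
    then have "(\<Sum>v\<in>V. if v \<in> Z2 then 1 else 0 :: real) = card Z2" "(\<Sum>v\<in>V. if v \<in> Z0 then 1 else 0 :: real) = card Z0"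
      by (simp_all flip: sum.inter_restrict)
    then show ?thesis by (simp add: sum.distrib sum_subtractf n_def)
  qed
  also have "\<dots> \<le> (\<Sum>v\<in>V. real (card (miss v)))"
    by (rule sum_mono) (auto simp: Z2_def Z0_def)
  also have "\<dots> = (\<Sum>x\<in>Q. real (card {v\<in>V. \<not> adj x v}))"
  proof -
    have "(\<Sum>v\<in>V. card (miss v)) = (\<Sum>x\<in>Q. card {v\<in>V. \<not> adj x v})"
      unfolding miss_def using finQ by (intro sum_multicount_gen) auto
    then show ?thesis by (simp flip: of_nat_sum)
  qed
  also have "\<dots> \<le> (\<Sum>x\<in>Q. (1 / r + \<beta>) * n)"
  proof (rule sum_mono)
    fix x assume "x \<in> Q"
    then show "real (card {v\<in>V. \<not> adj x v}) \<le> (1 / r + \<beta>) * n"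
      using deg[of x] card_nonadj[of x] Q(1) by (auto simp: n_def algebra_simps)
  qed
  also have "\<dots> = n + r * \<beta> * n" using Q by (simp add: field_simps)
  finally have Z2: "real (card Z2) \<le> r * \<beta> * n + \<beta> * n" using Z0 by simp
  define Z where "Z = Z0 \<union> Z2"
  have finZ: "finite Z" by (simp add: Z_def Z0_def Z2_def)
  have "card Z \<le> card Z0 + card Z2" unfolding Z_def by (rule card_Un_le)
  then have cZ: "real (card Z) \<le> (real r + 2) * \<beta> * n" using Z0 Z2 by (simp add: algebra_simps)
  obtain h where h: "bij_betw h Q {0..<card Q}" using ex_bij_betw_finite_nat[OF finQ] by blast
  \<comment> \<open>Outside \<open>Z\<close> the set \<open>miss v\<close> is a singleton and the
    choice is forced. On \<open>Z\<close> the default \<open>0\<close> and the \<open>SOME\<close>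
    are harmless, because every pair meeting \<open>Z\<close> is charged anyway.\<close>
  define p where "p v = (if miss v = {} then 0 else h (SOME x. x \<in> miss v))" for v
  have pr: "p v < r" for v
  proof (cases "miss v = {}")
    case False
    then have "(SOME x. x \<in> miss v) \<in> Q" using some_in_eq[of "miss v"] by (auto simp: miss_def)
    then show ?thesis using h Q False by (auto simp: p_def bij_betw_def)
  qed (use Q in \<open>simp add: p_def\<close>)
  let ?I = "{(u, v). adj u v \<and> p u = p v}"
  have "?I \<subseteq> (Z \<times> V) \<union> ((V \<times> Z) \<union> (\<Union>x\<in>Q. edges_in (Q - {x})))"
  proof
    fix e assume "e \<in> ?I"
    then obtain u v where e: "e = (u, v)" "adj u v" "p u = p v" by auto
    have uv: "u \<in> V" "v \<in> V" using adj_V[OF e(2)] by auto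
    show "e \<in> (Z \<times> V) \<union> ((V \<times> Z) \<union> (\<Union>x\<in>Q. edges_in (Q - {x})))"
    proof (cases "u \<in> Z \<or> v \<in> Z")
      case False
      have one: "\<exists>x. miss y = {x} \<and> x \<in> Q \<and> p y = h x" if "y \<in> V" "y \<notin> Z" for y
      proof -
        have "card (miss y) \<noteq> 0" "\<not> 2 \<le> card (miss y)" using that by (auto simp: Z_def Z0_def Z2_def)
        then have "card (miss y) = 1" by linarith
        then obtain x where x: "miss y = {x}" using card_1_singletonE by blast
        then have "x \<in> Q" by (auto simp: miss_def)
        then show ?thesis using x by (auto simp: p_def)
      qed
      from one[of u] uv False obtain x where x: "miss u = {x}" "x \<in> Q" "p u = h x" by auto
      from one[of v] uv False obtain y where y: "miss v = {y}" "y \<in> Q" "p v = h y" by auto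
      have "x = y" using x y e(3) h by (auto simp: bij_betw_def dest: inj_onD)
      then have "(u, v) \<in> edges_in (Q - {x})"
        using x(1) y(1) uv e(2) by (auto simp: edges_in_def cnbrs_def miss_def)
      then show ?thesis using e(1) x(2) by blast
    qed (use e uv in auto)
  qed
  then have "card ?I \<le> card ((Z \<times> V) \<union> ((V \<times> Z) \<union> (\<Union>x\<in>Q. edges_in (Q - {x}))))"
    using finZ finQ finite_edges_in by (intro card_mono) auto
  also have "\<dots> \<le> card (Z \<times> V) + (card (V \<times> Z) + card (\<Union>x\<in>Q. edges_in (Q - {x})))"
    by (meson add_left_mono card_Un_le le_trans)
  also have "card (\<Union>x\<in>Q. edges_in (Q - {x})) \<le> (\<Sum>x\<in>Q. card (edges_in (Q - {x})))"
    by (rule card_UN_le[OF finQ])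
  finally have "card ?I \<le> 2 * (card Z * card V) + (\<Sum>x\<in>Q. card (edges_in (Q - {x})))"
    by (simp add: card_cartesian_product mult.commute)
  then have "real (card ?I) \<le> real (2 * (card Z * card V) + (\<Sum>x\<in>Q. card (edges_in (Q - {x}))))"
    by (simp only: of_nat_le_iff)
  also have "\<dots> = 2 * (real (card Z) * n) + real (\<Sum>x\<in>Q. card (edges_in (Q - {x})))"
    by (simp add: n_def)
  also have "\<dots> \<le> 2 * ((real r + 2) * \<beta> * n * n) + \<beta> * n^2"
    using cZ few(2) by (intro add_mono mult_left_mono mult_right_mono) (auto simp: n_def)
  also have "\<dots> = (2 * real r + 5) * \<beta> * n^2"
    by (simp add: algebra_simps power2_eq_square)
  finally show ?thesis using pr by (intro exI[of _ p]) (simp add: n_def)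
qed

section \<open>From the partition to the Turan graph\<close>

lemma card_adj_pairs: "V \<noteq> {} \<Longrightarrow> real (card {(u, v). adj u v}) = cdens 2 * real (card V) ^ 2"
proof -
  assume V: "V \<noteq> {}"
  have "{(u, v). adj u v} = (SIGMA u:V. cnbrs {u})"
    using adj_V by (auto simp: cnbrs_def)
  then have "card {(u, v). adj u v} = (\<Sum>u\<in>V. deg u)" by (simp add: deg_def)
  then show ?thesis using sum_deg[OF V] by simp
qed

lemma edges_subset_pairs: "edges G \<subseteq> (\<lambda>(u, v). {u, v}) ` {(u, v). adj u v}"
proof
  fix e assume e: "e \<in> edges G"
  then have "card e = 2" using simple by (simp add: simple_graph_def)
  then obtain u v where uv: "e = {u, v}" by (auto simp: card_2_iff)
  show "e \<in> (\<lambda>(u, v). {u, v}) ` {(u, v). adj u v}"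
    by (rule image_eqI[of _ _ "(u, v)"]) (use e uv in auto)
qed

text \<open>Nearly all edges run between parts, so the density assumption leaves at most about
  \<open>n^2 / r\<close> ordered pairs inside parts, while Cauchy-Schwarz gives at least
  \<open>n^2 / r\<close>. Near equality means that few cross pairs are missing and that part sizes
  are close to \<open>n/r\<close>. The size deviation is controlled through its square, hence
  \<open>\<sigma>^2\<close> in the assumptions and \<open>\<sigma>\<close> in the conclusion;
  \<open>1 \<le> \<sigma> * n\<close> absorbs rounding.\<close>

lemma close_to_turan_graph:
  fixes p :: "'a \<Rightarrow> nat"
  assumes V: "V \<noteq> {}" and r: "0 < r" and p: "\<forall>v\<in>V. p v < r"
    and inside: "real (card {(u, v). adj u v \<and> p u = p v}) \<le> \<gamma> * real (card V) ^ 2"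
    and dens: "1 - 1 / r - c' \<le> cdens 2"
    and \<sigma>: "0 < \<sigma>" "\<sigma> \<le> 1" "c' + \<gamma> \<le> \<sigma>^2" "\<gamma> \<le> \<sigma>^2" "1 \<le> \<sigma> * real (card V)"
  shows "\<exists>p'. is_turan_graph r (card V) (multipartite V p') \<and>
    real (card ((edges (multipartite V p') - edges G) \<union> (edges G - edges (multipartite V p'))))
      \<le> (4 * real r + 2) * \<sigma> * real (card V) ^ 2"
proof -
  define n where "n = real (card V)"
  have n: "n > 0" using V by (simp add: n_def card_gt_0_iff)
  define N where "N i = card {v\<in>V. p v = i}" for i
  \<comment> \<open>All counts are of ordered pairs: adjacent (\<open>A\<close>), adjacent within a
    part (\<open>I\<close>), across parts (\<open>P\<close>), within a part (\<open>S\<close>). The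
    diagonal belongs to \<open>S\<close>, so \<open>P\<close> and \<open>S\<close> partition
    \<open>V \<times> V\<close>.\<close>
  define A where "A = {(u, v). adj u v}"
  define I where "I = {(u, v). adj u v \<and> p u = p v}"
  define P where "P = {(u, v). u \<in> V \<and> v \<in> V \<and> p u \<noteq> p v}"
  define S where "S = {(u, v). u \<in> V \<and> v \<in> V \<and> p u = p v}"
  have fin: "finite P" "finite S" by (rule finite_subset[of _ "V \<times> V"]; auto simp: P_def S_def)+
  have finA: "finite A" by (rule finite_subset[of _ "V \<times> V"]) (use adj_V in \<open>auto simp: A_def\<close>)
  have cI: "real (card I) \<le> \<gamma> * n^2" using inside by (simp add: I_def n_def)
  have cA: "(1 - 1 / r - c') * n^2 \<le> real (card A)"
    using card_adj_pairs[OF V] dens by (simp add: A_def n_def mult_right_mono)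
  have "card (P \<union> S) = card P + card S"
    using fin by (intro card_Un_disjoint) (auto simp: P_def S_def)
  moreover have "P \<union> S = V \<times> V" by (auto simp: P_def S_def)
  ultimately have cPS: "real (card P) + real (card S) = n^2"
    by (simp add: n_def power2_eq_square card_cartesian_product flip: of_nat_add of_nat_mult)
  have "card (I \<union> (A \<inter> P)) = card I + card (A \<inter> P)"
    using finA by (intro card_Un_disjoint) (auto simp: I_def A_def P_def intro: finite_subset[OF _ finA])
  moreover have "I \<union> (A \<inter> P) = A" using adj_V by (auto simp: I_def A_def P_def)
  ultimately have cAP: "real (card A) = real (card I) + real (card (A \<inter> P))" by simp
  have "card (P - A) + card (A \<inter> P) = card P"
    using fin(1) by (metis Int_commute add.commute card_Int_Diff)
  then have cPA: "real (card (P - A)) = real (card P) - real (card (A \<inter> P))" by simp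
  have "S = (\<Union>i<r. {v\<in>V. p v = i} \<times> {v\<in>V. p v = i})" using p by (auto simp: S_def)
  then have "card S = card (\<Union>i<r. {v\<in>V. p v = i} \<times> {v\<in>V. p v = i})" by simp
  also have "\<dots> = (\<Sum>i<r. card ({v\<in>V. p v = i} \<times> {v\<in>V. p v = i}))"
    by (intro card_UN_disjoint) auto
  finally have cS: "real (card S) = (\<Sum>i<r. real (N i) ^ 2)"
    by (simp add: card_cartesian_product N_def power2_eq_square)
  have "(\<Sum>i<r. N i) = card V" using sum_card_parts[OF finV p] by (simp add: N_def)
  then have sumN: "(\<Sum>i<r. real (N i)) = n" unfolding n_def by (simp flip: of_nat_sum)
  have "n^2 \<le> (\<Sum>i<r. real (N i) ^ 2) * real (card {..<r})"
    unfolding sumN[symmetric] by (rule sum_squared_le_sum_of_squares)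
  then have S_ge: "n^2 / r \<le> real (card S)" using r by (simp add: cS field_simps)
  have S_le: "real (card S) \<le> n^2 / r + (c' + \<gamma>) * n^2"
  proof -
    have "real (card (A \<inter> P)) \<le> real (card P)" using fin by (simp add: card_mono)
    then show ?thesis using cPS cAP cA cI by (simp add: algebra_simps)
  qed
  have PA: "real (card (P - A)) \<le> \<sigma>^2 * n^2"
  proof -
    have "real (card (P - A)) \<le> (c' + \<gamma>) * n^2"
      using cPA cPS cAP cA cI S_ge by (simp add: algebra_simps)
    also have "\<dots> \<le> \<sigma>^2 * n^2" using \<sigma> by (intro mult_right_mono) auto
    finally show ?thesis .
  qed
  have Idev: "real (card I) \<le> \<sigma>^2 * n^2"
    using cI mult_right_mono[OF \<sigma>(4), of "n^2"] by simp
  \<comment> \<open>The squared deviations of the part sizes from \<open>n/r\<close> sum to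
    \<open>card S - n^2 / r\<close>, so each single one is small. Truncated subtraction records only
    an excess, as \<open>rebalance_partition\<close> requires.\<close>
  have dev: "real (N i - turan_size r (card V) i) \<le> \<sigma> * n + 1" if i: "i < r" for i
  proof -
    have "(real (N i) - n / r)^2 \<le> (\<Sum>j<r. (real (N j) - n / r)^2)"
      using i by (intro member_le_sum) auto
    also have "\<dots> = (\<Sum>j<r. real (N j)^2 - 2 * (n / r) * real (N j) + (n / r)^2)"
      by (intro sum.cong refl) (simp add: power2_eq_square algebra_simps)
    also have "\<dots> = (\<Sum>j<r. real (N j)^2) - 2 * (n / r) * (\<Sum>j<r. real (N j)) + r * (n / r)^2"
      by (simp add: sum.distrib sum_subtractf sum_distrib_left)
    also have "\<dots> = real (card S) - n^2 / r"
      using r by (simp add: cS sumN power2_eq_square)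
    also have "\<dots> \<le> (c' + \<gamma>) * n^2" using S_le by simp
    also have "\<dots> \<le> \<sigma>^2 * n^2" using \<sigma> by (intro mult_right_mono) auto
    finally have "(real (N i) - n / r)^2 \<le> (\<sigma> * n)^2" by (simp add: power_mult_distrib)
    then have "real (N i) - n / r \<le> \<sigma> * n" by (rule power2_le_imp_le) (use \<sigma> n in simp)
    moreover have "n / r - 1 \<le> real (turan_size r (card V) i)"
      using turan_size_bounds[OF r] by (simp add: n_def)
    moreover have "0 \<le> \<sigma> * n" using \<sigma> n by simp
    ultimately show ?thesis by (cases "turan_size r (card V) i \<le> N i") (auto simp: of_nat_diff)
  qed
  obtain p' where p': "\<forall>v\<in>V. p' v < r" "\<forall>i<r. card {v\<in>V. p' v = i} = turan_size r (card V) i"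
      "card {v\<in>V. p v \<noteq> p' v} \<le> (\<Sum>i<r. N i - turan_size r (card V) i)"
    using rebalance_partition[OF finV p sum_turan_size[OF r]] unfolding N_def by (elim exE conjE)
  define D where "D = card {v\<in>V. p v \<noteq> p' v}"
  have "real D \<le> (\<Sum>i<r. real (N i - turan_size r (card V) i))"
    using p'(3) unfolding D_def by (metis of_nat_le_iff of_nat_sum)
  also have "\<dots> \<le> (\<Sum>i<r. \<sigma> * n + 1)" using dev by (intro sum_mono) auto
  also have "\<dots> = r * (\<sigma> * n + 1)" by simp
  finally have D: "real D \<le> r * (\<sigma> * n + 1)" .
  let ?T = "multipartite V p'" and ?M = "multipartite V p"
  have c1: "card (edges ?T - edges ?M) \<le> D * card V"
    using card_multipartite_diff_le[OF finV, of p' p] by (simp add: D_def eq_commute)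
  have c2: "card (edges ?M - edges ?T) \<le> D * card V"
    using card_multipartite_diff_le[OF finV, of p p'] by (simp add: D_def)
  have "edges ?M - edges G \<subseteq> (\<lambda>(u, v). {u, v}) ` (P - A)"
  proof
    fix e assume e: "e \<in> edges ?M - edges G"
    then obtain u v where "e = {u, v}" "u \<in> V" "v \<in> V" "p u \<noteq> p v" by (auto simp: multipartite_def)
    then show "e \<in> (\<lambda>(u, v). {u, v}) ` (P - A)" using e
      by (intro image_eqI[of _ _ "(u, v)"]) (auto simp: P_def A_def)
  qed
  then have c3: "card (edges ?M - edges G) \<le> card (P - A)" using fin by (intro surj_card_le) auto
  have "edges G - edges ?M \<subseteq> (\<lambda>(u, v). {u, v}) ` I"
  proof
    fix e assume e: "e \<in> edges G - edges ?M"
    then obtain u v where uv: "e = {u, v}" "adj u v" using edges_subset_pairs by auto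
    then have "p u = p v" using e adj_V[OF uv(2)] multipartite_adj[of u v V p] by blast
    then show "e \<in> (\<lambda>(u, v). {u, v}) ` I" using uv
      by (intro image_eqI[of _ _ "(u, v)"]) (auto simp: I_def)
  qed
  moreover have "finite I" using finA by (rule finite_subset[rotated]) (auto simp: I_def A_def)
  ultimately have c4: "card (edges G - edges ?M) \<le> card I" by (intro surj_card_le)
  have fin_edges: "finite (edges H)" if "simple_graph H" "verts H = V" for H :: "'a graph"
    by (rule finite_subset[of _ "Pow V"]) (use that in \<open>auto simp: simple_graph_def\<close>)
  have finE: "finite (edges G)" "finite (edges ?T)" "finite (edges ?M)"
    using fin_edges simple simple_multipartite[OF finV] by simp_all
  \<comment> \<open>Triangle inequality for symmetric differences, via the complete multipartite
    graph \<open>?M\<close> of the unbalanced partition.\<close>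
  let ?X = "(edges ?T - edges ?M) \<union> (edges ?M - edges ?T) \<union> ((edges ?M - edges G) \<union> (edges G - edges ?M))"
  have "card ((edges ?T - edges G) \<union> (edges G - edges ?T)) \<le> card ?X"
    using finE by (intro card_mono) auto
  also have "\<dots> \<le> card (edges ?T - edges ?M) + card (edges ?M - edges ?T) + (card (edges ?M - edges G) + card (edges G - edges ?M))"
    by (rule order_trans[OF card_Un_le add_mono[OF card_Un_le card_Un_le]])
  also have "\<dots> \<le> D * card V + D * card V + (card (P - A) + card I)"
    using c1 c2 c3 c4 by (intro add_mono)
  finally have "real (card ((edges ?T - edges G) \<union> (edges G - edges ?T))) \<le> real (D * card V + D * card V + (card (P - A) + card I))"
    by (simp only: of_nat_le_iff)
  also have "\<dots> = 2 * (real D * n) + (real (card (P - A)) + real (card I))" by (simp add: n_def)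
  also have "\<dots> \<le> 2 * (r * (\<sigma> * n + 1) * n) + (\<sigma>^2 * n^2 + \<sigma>^2 * n^2)"
    using D PA Idev n by (intro add_mono mult_left_mono mult_right_mono) auto
  also have "\<dots> \<le> 2 * (r * (\<sigma> * n + \<sigma> * n) * n) + (\<sigma> * n^2 + \<sigma> * n^2)"
  proof -
    have "\<sigma>^2 \<le> \<sigma>" using \<sigma> by (simp add: power2_eq_square mult_left_le)
    then show ?thesis using \<sigma>(5) n unfolding n_def
      by (intro add_mono mult_left_mono mult_right_mono) auto
  qed
  also have "\<dots> = (4 * real r + 2) * \<sigma> * n^2" by (simp add: algebra_simps power2_eq_square)
  finally have "real (card ((edges ?T - edges G) \<union> (edges G - edges ?T))) \<le> (4 * real r + 2) * \<sigma> * n^2" .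
  moreover have "is_turan_graph r (card V) ?T"
    using is_turan_graph_multipartite[OF finV r p'(1,2)] .
  ultimately show ?thesis unfolding n_def by (intro exI[of _ p'] conjI)
qed

text \<open>Chaining gives \<open>t_4 \<le> (1 - x) * (1 - 2 * x) * (1 - 3 * x) + 3 * c\<close> with
  \<open>x = 1/r\<close>. Subtracting this from the lower bound on \<open>t_2^2 + t_4\<close> leaves
  \<open>t_2^2 \<ge> (1 - x)^2 - (3 * c + 2 * \<kappa>)\<close>.\<close>

lemma edge_density_of_C4_density:
  assumes V: "V \<noteq> {}" and r: "3 \<le> r"
    and chain: "\<forall>s\<in>{1..r}. cdens (Suc s) \<le> (1 - s / r) * cdens s + c" and c: "0 \<le> c"
    and many: "((1 - 1 / r) * (1 - 3 / r + 3 / (real r)^2) - \<kappa>) * real (card V) ^ 4 \<le> 8 * real (num_copies C4 G)"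
    and \<kappa>: "0 \<le> \<kappa>"
  shows "1 - 1 / r - (6 * c + 4 * \<kappa>) \<le> cdens 2"
proof -
  define n where "n = real (card V)"
  have n: "n > 0" using V by (simp add: n_def card_gt_0_iff)
  define x where "x = 1 / real r"
  have x: "0 < x" "3 * x \<le> 1" using r by (auto simp: x_def field_simps)
  have xs: "2 / real r = 2 * x" "3 / real r = 3 * x" "1 / real r = x" "3 / (real r)^2 = 3 * x^2"
    by (simp_all add: x_def power_divide)
  have ch: "cdens 2 \<le> (1 - x) * 1 + c" "cdens 3 \<le> (1 - 2 * x) * cdens 2 + c" "cdens 4 \<le> (1 - 3 * x) * cdens 3 + c"
    using chain[rule_format, of 1] chain[rule_format, of 2] chain[rule_format, of 3] r cdens_1[OF V]
    by (simp_all add: xs numeral_2_eq_2 numeral_3_eq_3 eval_nat_numeral)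
  have "cdens 3 \<le> (1 - 2 * x) * ((1 - x) * 1 + c) + c"
    by (rule order_trans[OF ch(2)]) (use ch(1) x in \<open>auto intro!: mult_left_mono\<close>)
  also have "\<dots> \<le> (1 - 2 * x) * (1 - x) + 2 * c"
    using x c by (simp add: algebra_simps)
  finally have c3: "cdens 3 \<le> (1 - 2 * x) * (1 - x) + 2 * c" .
  have "cdens 4 \<le> (1 - 3 * x) * ((1 - 2 * x) * (1 - x) + 2 * c) + c"
    by (rule order_trans[OF ch(3)]) (use c3 x in \<open>auto intro!: mult_left_mono\<close>)
  also have "\<dots> \<le> (1 - 3 * x) * ((1 - 2 * x) * (1 - x)) + 3 * c"
    using x c by (simp add: algebra_simps)
  finally have c4: "cdens 4 \<le> (1 - 3 * x) * ((1 - 2 * x) * (1 - x)) + 3 * c" .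
  have "2 * ((1 - x) * (1 - 3 * x + 3 * x^2) - \<kappa>) * n ^ 4 \<le> (cdens 2 ^ 2 + cdens 4) * n ^ 4"
    using many num_copies_C4_le[OF V] unfolding xs n_def by linarith
  then have "2 * ((1 - x) * (1 - 3 * x + 3 * x^2) - \<kappa>) \<le> cdens 2 ^ 2 + cdens 4"
    using n by simp
  also have "\<dots> \<le> cdens 2 ^ 2 + ((1 - 3 * x) * ((1 - 2 * x) * (1 - x)) + 3 * c)"
    using c4 by simp
  finally have sq: "(1 - x)^2 - (3 * c + 2 * \<kappa>) \<le> cdens 2 ^ 2"
    by (simp add: algebra_simps power2_eq_square)
  show ?thesis
  proof (rule ccontr)
    assume "\<not> ?thesis"
    then have *: "6 * c + 4 * \<kappa> < (1 - x) - cdens 2" by (simp add: xs)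
    \<comment> \<open>Difference of squares; since \<open>x \<le> 1/3\<close>, the factor
      \<open>1 - x + cdens 2\<close> exceeds \<open>1/2\<close>, which accounts for the doubling of
      \<open>3 * c + 2 * \<kappa>\<close>.\<close>
    have "1 / 2 * (6 * c + 4 * \<kappa>) < (1 - x + cdens 2) * ((1 - x) - cdens 2)"
      using * x c \<kappa> by (intro mult_le_less_imp_less) (auto simp: add_increasing2)
    then show False using sq by (simp add: algebra_simps power2_eq_square)
  qed
qed

end

theorem theorem1p6:
  fixes r :: nat and F :: "'a graph"
  assumes "r \<ge> 3"
    and "simple_graph F"
    and "chromatic_number F = r + 1"
    and "\<exists>e. color_critical_edge F e"
  shows "\<forall>\<epsilon>::real. \<epsilon> > 0 \<longrightarrow>
    (\<exists>\<delta>::real. \<delta> > 0 \<and> (\<exists>n0::nat. \<forall>n \<ge> n0. \<forall>G :: nat graph.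
       simple_graph G \<and> card (verts G) = n \<and> free_of F G \<and>
       real (num_copies C4 G) \<ge> real (ex_turan n C4 F) - \<delta> * real n ^ 4 \<longrightarrow>
       (\<exists>T :: nat graph. is_turan_graph r n T \<and> verts T = verts G \<and>
          real (card ((edges T - edges G) \<union> (edges G - edges T))) \<le> \<epsilon> * real n ^ 2)))"
proof (intro allI impI)
  fix \<epsilon> :: real assume \<epsilon>: "0 < \<epsilon>"
  have r: "0 < r" "r \<ge> 3" using assms(1) by auto
  \<comment> \<open>The constants are chosen backwards from \<open>\<epsilon>\<close>;
    \<open>4 * r + 2\<close> is the factor lost in \<open>close_to_turan_graph\<close>.\<close>
  define \<sigma> where "\<sigma> = min 1 (\<epsilon> / (4 * real r + 2))"
  have \<sigma>: "0 < \<sigma>" "\<sigma> \<le> 1" using \<epsilon> by (auto simp: \<sigma>_def)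
  have \<sigma>\<epsilon>: "(4 * real r + 2) * \<sigma> \<le> \<epsilon>"
  proof -
    have "(4 * real r + 2) * \<sigma> \<le> (4 * real r + 2) * (\<epsilon> / (4 * real r + 2))"
      by (intro mult_left_mono) (auto simp: \<sigma>_def)
    then show ?thesis by simp
  qed
  \<comment> \<open>The first bound allows cliques of high degree vertices to be extended; the
    second makes the proportion \<open>\<gamma>\<close> of pairs inside parts at most
    \<open>\<sigma>^2 / 2\<close>.\<close>
  define \<beta> where "\<beta> = min (1 / (2 * real r ^ 2)) (\<sigma>^2 / (2 * (2 * real r + 5)))"
  have \<beta>: "0 < \<beta>" "\<beta> \<le> 1 / (2 * real r ^ 2)" "\<beta> \<le> \<sigma>^2 / (2 * (2 * real r + 5))"
    using r \<sigma> by (auto simp: \<beta>_def)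
  define \<gamma> where "\<gamma> = (2 * real r + 5) * \<beta>"
  have \<gamma>: "\<gamma> \<le> \<sigma>^2 / 2"
  proof -
    have "\<gamma> \<le> (2 * real r + 5) * (\<sigma>^2 / (2 * (2 * real r + 5)))"
      unfolding \<gamma>_def using \<beta> by (intro mult_left_mono) auto
    also have "\<dots> = \<sigma>^2 / 2"
    proof -
      have cancel: "a * (b / (2 * a)) = b / 2" if "a > 0" for a b :: real using that by simp
      show ?thesis by (rule cancel) simp
    qed
    finally show ?thesis .
  qed
  have \<beta>\<gamma>: "\<beta> \<le> \<gamma>" using \<beta> by (simp add: \<gamma>_def)
  have \<beta>1: "\<beta> \<le> 1" using \<beta>\<gamma> \<gamma> \<sigma> power_le_one[of \<sigma> 2] by linarith
  have \<beta>3: "0 < \<beta> ^ 3" "\<beta> ^ 3 \<le> \<beta>"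
    using \<beta>(1) \<beta>1 power_decreasing[of 1 3 \<beta>] by auto
  \<comment> \<open>The deficit allowed in the edge density. The cube comes from the Chebyshev
    estimate, and half of \<open>\<beta>^3\<close> leaves room for \<open>c\<close>.\<close>
  define c' where "c' = \<beta> ^ 3 / 2"
  define c where "c = c' / 18"
  have c: "0 < c'" "0 < c" "c + c' \<le> \<beta> ^ 3" "c' + \<gamma> \<le> \<sigma>^2"
    using \<beta>3 \<gamma> \<beta>\<gamma> by (auto simp: c_def c'_def)
  obtain \<eta>1 where \<eta>1: "\<eta>1 > 0" "\<forall>G :: nat graph. simple_graph G \<longrightarrow> finite_graph.cdens G (Suc r) \<le> \<eta>1 \<longrightarrow>
           (\<forall>s\<in>{1..r}. finite_graph.cdens G (Suc s) \<le> (1 - s / r) * finite_graph.cdens G s + c)"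
    using cdens_chain[OF c(2) r(1)] by (elim exE conjE)
  define K where "K = (real r + 1)^2 * (2 * r) ^ r * fact r"
  have K: "K > 0" using r by (simp add: K_def)
  \<comment> \<open>The density of \<open>K_(r+1)\<close> must be small enough both for the chain
    (\<open>\<eta>1\<close>) and for the averaging over cliques
    (\<open>\<beta> / K\<close>).\<close>
  define \<eta> where "\<eta> = min \<eta>1 (\<beta> / K)"
  have \<eta>: "\<eta> > 0" "\<eta> \<le> \<eta>1" "\<eta> * K \<le> \<beta>"
    using \<eta>1 \<beta> K by (auto simp: \<eta>_def pos_le_divide_eq[symmetric])
  obtain n1 where n1: "\<forall>G :: nat graph. simple_graph G \<longrightarrow> free_of F G \<longrightarrow> card (verts G) \<ge> n1 \<longrightarrow>
           finite_graph.cdens G (chromatic_number F) \<le> \<eta>"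
    using free_of_cdens_le[OF assms(2) \<eta>(1)] by (elim exE)
  \<comment> \<open>The deficit contributes \<open>8 * \<delta> * n^4 = c'/12 * n^4\<close>, and
    \<open>9 * n^3\<close> is at most the same amount once \<open>n \<ge> 108 / c'\<close>; together
    they make up \<open>\<kappa> = c'/6\<close>.\<close>
  define \<delta> where "\<delta> = c' / 96"
  define n0 where "n0 = Max {n1, 6, nat \<lceil>1 / \<sigma>\<rceil>, nat \<lceil>108 / c'\<rceil>}"
  show "\<exists>\<delta>::real. \<delta> > 0 \<and> (\<exists>n0::nat. \<forall>n \<ge> n0. \<forall>G :: nat graph.
       simple_graph G \<and> card (verts G) = n \<and> free_of F G \<and>
       real (num_copies C4 G) \<ge> real (ex_turan n C4 F) - \<delta> * real n ^ 4 \<longrightarrow>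
       (\<exists>T :: nat graph. is_turan_graph r n T \<and> verts T = verts G \<and>
          real (card ((edges T - edges G) \<union> (edges G - edges T))) \<le> \<epsilon> * real n ^ 2))"
  proof (rule exI[of _ \<delta>], rule conjI, use c in \<open>simp add: \<delta>_def\<close>, rule exI[of _ n0], intro allI impI, elim conjE)
    fix n and G :: "nat graph"
    assume nn0: "n0 \<le> n" and G: "simple_graph G" "card (verts G) = n" "free_of F G"
      and many: "real (ex_turan n C4 F) - \<delta> * real n ^ 4 \<le> real (num_copies C4 G)"
    interpret finite_graph G using G(1) by unfold_locales
    have ns: "n1 \<le> n" "6 \<le> n" "nat \<lceil>1 / \<sigma>\<rceil> \<le> n" "nat \<lceil>108 / c'\<rceil> \<le> n"
      using nn0 by (auto simp: n0_def)
    have n\<sigma>: "1 \<le> \<sigma> * real n" and nc: "108 / c' \<le> real n"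
    proof -
      have "1 / \<sigma> \<le> real n" using ns(3) by linarith
      then show "1 \<le> \<sigma> * real n" using \<sigma> by (simp add: field_simps)
      show "108 / c' \<le> real n" using ns(4) by linarith
    qed
    have V: "V \<noteq> {}" using ns(2) G(2) by auto
    have few: "cdens (Suc r) \<le> \<eta>" using n1 G ns(1) assms(3) by simp
    have chain: "\<forall>s\<in>{1..r}. cdens (Suc s) \<le> (1 - s / r) * cdens s + c"
      using \<eta>1(2) G(1) few \<eta>(2) by (meson order_trans)
    \<comment> \<open>With \<open>c = c'/18\<close> this gives
      \<open>6 * c + 4 * \<kappa> = c'/3 + 2 * c'/3 = c'\<close>.\<close>
    define \<kappa> where "\<kappa> = c' / 6"
    have dens: "1 - 1 / r - (6 * c + 4 * \<kappa>) \<le> cdens 2"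
    proof (rule edge_density_of_C4_density[OF V r(2) chain])
      show "0 \<le> c" "0 \<le> \<kappa>" using c by (auto simp: \<kappa>_def)
      have "9 * real n ^ 3 \<le> c' / 12 * real n ^ 4"
      proof -
        have "108 \<le> c' * real n" using nc c by (simp add: field_simps)
        then have "108 * real n ^ 3 \<le> c' * real n * real n ^ 3" by (intro mult_right_mono) auto
        then show ?thesis by (simp add: power4_eq_xxxx power3_eq_cube)
      qed
      moreover have "8 * \<delta> = c' / 12" by (simp add: \<delta>_def)
      moreover have "8 * real (ex_turan n C4 F) \<ge> (1 - 1 / r) * (1 - 3 / r + 3 / (real r)^2) * real n ^ 4 - 9 * real n ^ 3"
        using ex_turan_C4_ge[of r F n] r ns assms(3) by simp
      ultimately have "(1 - 1 / r) * (1 - 3 / r + 3 / (real r)^2) * real n ^ 4 - c' / 12 * real n ^ 4 - c' / 12 * real n ^ 4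
          \<le> 8 * real (num_copies C4 G)"
        using many by (simp add: \<delta>_def)
      then show "((1 - 1 / r) * (1 - 3 / r + 3 / (real r)^2) - \<kappa>) * real (card V) ^ 4 \<le> 8 * real (num_copies C4 G)"
        unfolding G(2) \<kappa>_def by (simp add: left_diff_distrib)
    qed
    then have dens': "1 - 1 / r - c' \<le> cdens 2" by (simp add: c_def \<kappa>_def)
    define W where "W = {v\<in>V. (1 - 1 / r - \<beta>) * card V \<le> real (deg v)}"
    have W: "W \<subseteq> V" by (auto simp: W_def)
    have "real (card {v\<in>V. real (deg v) < (1 - 1 / r - \<beta>) * card V}) \<le> \<beta> * card V"
    proof (rule card_low_degree_le[OF V _ _ \<beta>(1)])
      show "0 \<le> 1 - 1 / real r" "1 - 1 / real r \<le> 1" using r by auto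
      show "0 \<le> c'" "c + c' \<le> \<beta> ^ 3" "0 \<le> c" "1 - 1 / real r - c' \<le> cdens 2" using c dens' by auto
      show "cdens 3 \<le> (2 * (1 - 1 / real r) - 1) * cdens 2 + c"
        using chain[rule_format, of 2] r by (simp add: numeral_2_eq_2 numeral_3_eq_3)
    qed
    moreover have "V - W = {v\<in>V. real (deg v) < (1 - 1 / r - \<beta>) * card V}" by (auto simp: W_def)
    ultimately have cW: "real (card (V - W)) \<le> \<beta> * card V" by simp
    have degW: "(1 - 1 / r - \<beta>) * card V \<le> deg v" if "v \<in> W" for v using that by (simp add: W_def)
    have fewK: "cdens (Suc r) * ((real r + 1)^2 * (2 * r) ^ r * fact r) \<le> \<beta>"
    proof -
      have "cdens (Suc r) * K \<le> \<eta> * K" using few K by (intro mult_right_mono) auto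
      then have "cdens (Suc r) * K \<le> \<beta>" using \<eta>(3) by (rule order_trans)
      then show ?thesis unfolding K_def .
    qed
    have "\<exists>Q\<in>cliques W r. real (card (cnbrs Q)) \<le> \<beta> * card V
        \<and> real (\<Sum>x\<in>Q. card (edges_in (Q - {x}))) \<le> \<beta> * real (card V) ^ 2"
      by (rule exists_good_clique[OF W _ cW \<beta>(1,2) r(1) V fewK]) (rule degW)
    then obtain Q where Q: "Q \<in> cliques W r" "real (card (cnbrs Q)) \<le> \<beta> * card V"
        "real (\<Sum>x\<in>Q. card (edges_in (Q - {x}))) \<le> \<beta> * real (card V) ^ 2"
      by (elim bexE conjE)
    have "Q \<subseteq> W" "card Q = r" using Q(1) by (auto simp: cliques_def)
    then have "\<exists>p :: nat \<Rightarrow> nat. (\<forall>v\<in>V. p v < r)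
           \<and> real (card {(u, v). adj u v \<and> p u = p v}) \<le> (2 * real r + 5) * \<beta> * real (card V) ^ 2"
      using W degW r(1) Q(2,3) by (intro exists_partition_of_good_clique) auto
    then obtain p :: "nat \<Rightarrow> nat" where p: "\<forall>v\<in>V. p v < r"
        "real (card {(u, v). adj u v \<and> p u = p v}) \<le> \<gamma> * real (card V) ^ 2"
      unfolding \<gamma>_def by (elim exE conjE)
    have "\<gamma> \<le> \<sigma>^2" using c by linarith
    have "1 \<le> \<sigma> * real (card V)" using n\<sigma> G(2) by simp
    from close_to_turan_graph[OF V r(1) p dens' \<sigma> c(4) \<open>\<gamma> \<le> \<sigma>^2\<close> this]
    obtain p' where p': "is_turan_graph r (card V) (multipartite V p')"
        "real (card ((edges (multipartite V p') - edges G) \<union> (edges G - edges (multipartite V p'))))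
          \<le> (4 * real r + 2) * \<sigma> * real (card V) ^ 2"
      by (elim exE conjE)
    have "(4 * real r + 2) * \<sigma> * real n ^ 2 \<le> \<epsilon> * real n ^ 2" using \<sigma>\<epsilon> by (intro mult_right_mono) auto
    then show "\<exists>T :: nat graph. is_turan_graph r n T \<and> verts T = verts G \<and>
          real (card ((edges T - edges G) \<union> (edges G - edges T))) \<le> \<epsilon> * real n ^ 2"
      using p' G(2) by (intro exI[of _ "multipartite V p'"]) auto
  qed
qed

end
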